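(* Let $t \ge 3$ be an integer, and let $G$ be a $K_t$-minor-free graph of maximum degree $\Delta$ with $m$ edges. Then the line graph of $G$ has treewidth at most $(t-1)\left\lfloor \sqrt{(t-3)\Delta m} + \Delta\right\rfloor - 1$.
   Context: All graphs are finite, simple and undirected. A graph is $K_t$-minor-free if it does not contain the complete graph $K_t$ as a minor. The line graph $L(G)$ of $G$ is the graph with vertex set $E(G)$ in which two distinct edges $e,e'\in E(G)$ are adjacent if they share a common end in $G$. A tree-decomposition of a graph $G$ is a family $(B_u)_{u\in V(T)}$ of subsets of $V(G)$ (bags) indexed by the nodes of a tree $T$ such that $V(G)=\bigcup_u B_u$, every edge of $G$ has both ends in some bag, and $B_{u_1}\cap B_{u_3}\subseteq B_{u_2}$ whenever $u_2$ lies on the path between $u_1$ and $u_3$ in $T$. Its width is $\max\{|B_u|-1 : u\in V(T)\}$, and the treewidth of $G$ is the minimum width of its tree-decompositions (so the graph with no vertices has treewidth $-1$). *)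

theory Defs
  imports Complex_Main
begin

datatype 'a ugraph = Graph (verts: "'a set") (edges: "'a set set")

definition simple_graph :: "'a ugraph \<Rightarrow> bool" where
  "simple_graph G \<longleftrightarrow> finite (verts G) \<and> (\<forall>e\<in>edges G. e \<subseteq> verts G \<and> card e = 2)"

definition degree :: "'a ugraph \<Rightarrow> 'a \<Rightarrow> nat" where
  "degree G v = card {e \<in> edges G. v \<in> e}"

(* The inserted 0 only matters for the graph without vertices. *)
definition max_degree :: "'a ugraph \<Rightarrow> nat" where
  "max_degree G = Max (insert 0 (degree G ` verts G))"

definition is_path :: "'a ugraph \<Rightarrow> 'a \<Rightarrow> 'a list \<Rightarrow> 'a \<Rightarrow> bool" where
  "is_path G u p v \<longleftrightarrow> p \<noteq> [] \<and> hd p = u \<and> last p = v \<and> set p \<subseteq> verts G \<and> distinct p \<and>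
     successively (\<lambda>x y. {x, y} \<in> edges G) p"

definition connected_graph :: "'a ugraph \<Rightarrow> bool" where
  "connected_graph G \<longleftrightarrow> verts G \<noteq> {} \<and> (\<forall>u\<in>verts G. \<forall>v\<in>verts G. \<exists>p. is_path G u p v)"

definition acyclic_graph :: "'a ugraph \<Rightarrow> bool" where
  "acyclic_graph G \<longleftrightarrow> \<not> (\<exists>u p v. is_path G u p v \<and> length p \<ge> 3 \<and> {v, u} \<in> edges G)"

definition tree :: "'a ugraph \<Rightarrow> bool" where
  "tree T \<longleftrightarrow> simple_graph T \<and> connected_graph T \<and> acyclic_graph T"

definition induced_subgraph :: "'a ugraph \<Rightarrow> 'a set \<Rightarrow> 'a ugraph" where
  "induced_subgraph G X = Graph (verts G \<inter> X) {e \<in> edges G. e \<subseteq> X}"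

(* H is a minor of G: G has a model of H, with pairwise disjoint connected branch sets \<phi> x. *)
definition is_minor :: "'b ugraph \<Rightarrow> 'a ugraph \<Rightarrow> bool" where
  "is_minor H G \<longleftrightarrow> (\<exists>\<phi> :: 'b \<Rightarrow> 'a set.
     (\<forall>x\<in>verts H. \<phi> x \<subseteq> verts G \<and> connected_graph (induced_subgraph G (\<phi> x))) \<and>
     (\<forall>x\<in>verts H. \<forall>y\<in>verts H. x \<noteq> y \<longrightarrow> \<phi> x \<inter> \<phi> y = {}) \<and>
     (\<forall>x\<in>verts H. \<forall>y\<in>verts H. {x, y} \<in> edges H \<longrightarrow>
        (\<exists>u\<in>\<phi> x. \<exists>v\<in>\<phi> y. {u, v} \<in> edges G)))"

definition complete_graph :: "nat \<Rightarrow> nat ugraph" where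
  "complete_graph t = Graph {..<t} {{i, j} | i j. i < t \<and> j < t \<and> i \<noteq> j}"

definition line_graph :: "'a ugraph \<Rightarrow> 'a set ugraph" where
  "line_graph G =
     Graph (edges G) {{e, f} | e f. e \<in> edges G \<and> f \<in> edges G \<and> e \<noteq> f \<and> e \<inter> f \<noteq> {}}"

definition tree_decomposition :: "'a ugraph \<Rightarrow> 'n ugraph \<Rightarrow> ('n \<Rightarrow> 'a set) \<Rightarrow> bool" where
  "tree_decomposition G T B \<longleftrightarrow> tree T \<and>
     verts G = (\<Union>u\<in>verts T. B u) \<and>
     (\<forall>e\<in>edges G. \<exists>u\<in>verts T. e \<subseteq> B u) \<and>
     (\<forall>u\<^sub>1 p u\<^sub>3. is_path T u\<^sub>1 p u\<^sub>3 \<longrightarrow> (\<forall>u\<^sub>2\<in>set p. B u\<^sub>1 \<inter> B u\<^sub>3 \<subseteq> B u\<^sub>2))"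

definition width :: "'n ugraph \<Rightarrow> ('n \<Rightarrow> 'a set) \<Rightarrow> int" where
  "width T B = Max ((\<lambda>u. int (card (B u)) - 1) ` verts T)"

(* Trees are finite, so it is no restriction that the nodes are natural numbers. For a finite
   graph the minimum exists: all widths are at least -1, and a single bag is a decomposition. *)
definition treewidth :: "'a ugraph \<Rightarrow> int" where
  "treewidth G = (LEAST w. \<exists>(T :: nat ugraph) B. tree_decomposition G T B \<and> width T B = w)"

end

theory Submission
  imports Defs
begin

text \<open>
  Let \<open>k\<close> be the integer part of \<open>sqrt ((t - 3) * \<Delta> * m) + \<Delta>\<close>. The proof builds, from the top down,
  a tree-decomposition of the line graph whose bags have at most \<open>(t - 1) * k\<close> edges. At every
  stage there is a connected region \<open>W\<close> that is still to be decomposed, surrounded by pairwise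
  disjoint, pairwise touching connected sets \<open>C\<^sub>1, \<dots>, C\<^sub>s\<close> outside \<open>W\<close>: every edge leaving \<open>W\<close>
  ends in one of them, each of them touches \<open>W\<close>, and each sends at most \<open>k\<close> edges into \<open>W\<close>.
  Together with \<open>W\<close> they are a model of the complete graph on \<open>s + 1\<close> vertices, so \<open>s \<le> t - 2\<close>
  (\<open>clique_region_card\<close>), and the boundary of \<open>W\<close> has at most \<open>(t - 2) * k\<close> edges. This leaves
  room in the next bag for the boundary and \<open>k\<close> further edges, to be spent in one of two ways.

  If some connected set \<open>T\<close> of at most \<open>r\<close> vertices of \<open>W\<close> touches all \<open>C\<^sub>i\<close>, the bag receives
  the at most \<open>r * \<Delta>\<close> edges that meet \<open>T\<close>. The components of \<open>W - T\<close> are then treated separately,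
  with \<open>T\<close> as a new member of the surrounding family and with the sets that have lost contact
  dropped (\<open>extendable_by_connector\<close>).

  If there is no such \<open>T\<close>, then a set \<open>Z\<close> of at most \<open>(s - 1) * m / r\<close> edges splits \<open>W\<close> into
  pieces each of which misses some \<open>C\<^sub>i\<close> (\<open>small_connector_or_small_cut\<close>, an edge version of the
  lemma of Alon, Seymour and Thomas). The bag receives \<open>Z\<close>. For a piece \<open>K\<close> that misses \<open>C\<^sub>i\<close>, the
  set \<open>C\<^sub>i\<close> is replaced by \<open>C\<^sub>i \<union> (W - K)\<close>, whose edges to \<open>K\<close> all lie in \<open>Z\<close>. The new set is
  connected if \<open>Z\<close> has least size: a component \<open>L\<close> of \<open>W - K\<close> that does not touch \<open>C\<^sub>i\<close> could be
  merged with \<open>K\<close>, which would save the edges between them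
  (\<open>minimal_separating_component_touches\<close>, \<open>extendable_by_cut\<close>).

  Choosing \<open>r\<close> as \<open>sqrt ((t - 3) * m / \<Delta>)\<close>, rounded up, keeps both \<open>r * \<Delta>\<close> and \<open>(t - 3) * m / r\<close>
  within \<open>k\<close> (\<open>balanced_connector_size\<close>). In both cases the pieces are smaller than \<open>W\<close>, so the
  process ends. Every vertex is eventually put into some \<open>T\<close>, and then all edges at this vertex lie
  in a common bag, which takes care of the adjacencies of the line graph.
\<close>

section \<open>Connected vertex sets\<close>

text \<open>
  Connectedness is expressed by closure: a set closed under adjacency within \<open>X\<close> that meets \<open>X\<close>
  contains all of \<open>X\<close>. Most connectedness proofs then amount to watching such a set absorb one
  piece after the other; paths are needed only to return to the usual notion.
\<close>

definition conn :: "'a set set \<Rightarrow> 'a set \<Rightarrow> bool" where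
  "conn E X \<longleftrightarrow> X \<noteq> {} \<and>
     (\<forall>S. S \<inter> X \<noteq> {} \<longrightarrow> (\<forall>u\<in>S \<inter> X. \<forall>v\<in>X. {u, v} \<in> E \<longrightarrow> v \<in> S) \<longrightarrow> X \<subseteq> S)"

definition touching :: "'a set set \<Rightarrow> 'a set \<Rightarrow> 'a set \<Rightarrow> bool" where
  "touching E X Y \<longleftrightarrow> (\<exists>u\<in>X. \<exists>v\<in>Y. {u, v} \<in> E)"

definition components :: "'a set set \<Rightarrow> 'a set \<Rightarrow> 'a set set" where
  "components E X = {K. K \<subseteq> X \<and> conn E K \<and> (\<forall>L. K \<subseteq> L \<and> L \<subseteq> X \<and> conn E L \<longrightarrow> L = K)}"

lemma conn_subset_closed:
  assumes "conn E X" "a \<in> X" "a \<in> S" "\<And>u v. u \<in> S \<Longrightarrow> u \<in> X \<Longrightarrow> v \<in> X \<Longrightarrow> {u, v} \<in> E \<Longrightarrow> v \<in> S"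
  shows "X \<subseteq> S"
  using assms unfolding conn_def by (metis IntE IntI empty_iff)

lemma connI:
  assumes "X \<noteq> {}"
    and "\<And>S a. a \<in> X \<Longrightarrow> a \<in> S \<Longrightarrow> (\<And>u v. u \<in> S \<Longrightarrow> u \<in> X \<Longrightarrow> v \<in> X \<Longrightarrow> {u, v} \<in> E \<Longrightarrow> v \<in> S) \<Longrightarrow> X \<subseteq> S"
  shows "conn E X"
  using assms unfolding conn_def by (metis IntE IntI ex_in_conv)

lemma conn_singleton: "conn E {v}"
  by (auto simp: conn_def)

lemma conn_nonempty: "conn E X \<Longrightarrow> X \<noteq> {}"
  by (simp add: conn_def)

lemma touching_sym: "touching E X Y \<Longrightarrow> touching E Y X"
  unfolding touching_def by (metis insert_commute)

lemma conn_transfer: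
  assumes "conn E X" and "\<And>u v. u \<in> X \<Longrightarrow> v \<in> X \<Longrightarrow> {u, v} \<in> E \<Longrightarrow> {u, v} \<in> F"
  shows "conn F X"
proof (rule connI)
  fix S a
  assume a: "a \<in> X" "a \<in> S"
    and cl: "\<And>u v. u \<in> S \<Longrightarrow> u \<in> X \<Longrightarrow> v \<in> X \<Longrightarrow> {u, v} \<in> F \<Longrightarrow> v \<in> S"
  show "X \<subseteq> S" by (rule conn_subset_closed[OF assms(1) a]) (use assms(2) cl in blast)
qed (rule conn_nonempty[OF assms(1)])

text \<open>
  A closed set that meets the union absorbs one member, from there \<open>C\<close>, and from \<open>C\<close> every other
  member.
\<close>

lemma conn_Un_family:
  assumes C: "conn E C" and P: "\<And>P. P \<in> \<P> \<Longrightarrow> conn E P \<and> touching E C P"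
  shows "conn E (C \<union> \<Union>\<P>)"
proof (rule connI)
  show "C \<union> \<Union>\<P> \<noteq> {}" using conn_nonempty[OF C] by auto
next
  fix S a
  assume a: "a \<in> C \<union> \<Union>\<P>" "a \<in> S"
    and cl: "\<And>u v. u \<in> S \<Longrightarrow> u \<in> C \<union> \<Union>\<P> \<Longrightarrow> v \<in> C \<union> \<Union>\<P> \<Longrightarrow> {u, v} \<in> E \<Longrightarrow> v \<in> S"
  have absorb: "Q \<subseteq> S" if "Q = C \<or> Q \<in> \<P>" "b \<in> Q" "b \<in> S" for Q b
    by (rule conn_subset_closed[of E Q b]) (use that C P cl in blast)+
  have CS: "C \<subseteq> S"
  proof (cases "a \<in> C")
    case True
    then show ?thesis using absorb a by blast
  next
    case False
    then obtain Q where Q: "Q \<in> \<P>" "a \<in> Q" using a by blast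
    then have "Q \<subseteq> S" using absorb a by blast
    moreover obtain u v where "u \<in> C" "v \<in> Q" "{v, u} \<in> E"
      using P[OF Q(1)] unfolding touching_def by (metis insert_commute)
    ultimately have "u \<in> S" using cl Q(1) by blast
    then show ?thesis using absorb \<open>u \<in> C\<close> by blast
  qed
  have "Q \<subseteq> S" if Q: "Q \<in> \<P>" for Q
  proof -
    obtain u v where "u \<in> C" "v \<in> Q" "{u, v} \<in> E"
      using P[OF Q] unfolding touching_def by blast
    then have "v \<in> S" using cl CS Q by blast
    then show ?thesis using absorb Q \<open>v \<in> Q\<close> by blast
  qed
  with CS show "C \<union> \<Union>\<P> \<subseteq> S" by blast
qed

lemma conn_Un_touching:
  "conn E X \<Longrightarrow> conn E Y \<Longrightarrow> touching E X Y \<Longrightarrow> conn E (X \<union> Y)"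
  using conn_Un_family[of E X "{Y}"] by simp

lemma conn_Union_common:
  assumes "\<And>Q. Q \<in> \<Q> \<Longrightarrow> conn E Q \<and> v \<in> Q" "\<Q> \<noteq> {}"
  shows "conn E (\<Union>\<Q>)"
proof (rule connI)
  show "\<Union>\<Q> \<noteq> {}" using assms by blast
next
  fix S a
  assume a: "a \<in> \<Union>\<Q>" "a \<in> S"
    and cl: "\<And>x y. x \<in> S \<Longrightarrow> x \<in> \<Union>\<Q> \<Longrightarrow> y \<in> \<Union>\<Q> \<Longrightarrow> {x, y} \<in> E \<Longrightarrow> y \<in> S"
  have absorb: "Q \<subseteq> S" if "Q \<in> \<Q>" "b \<in> Q" "b \<in> S" for Q b
    by (rule conn_subset_closed[of E Q b]) (use that assms cl in blast)+
  have "v \<in> S" using a absorb assms by blast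
  then show "\<Union>\<Q> \<subseteq> S" using absorb assms by blast
qed

lemma componentsD:
  assumes "K \<in> components E X"
  shows "K \<subseteq> X" "conn E K" "\<And>L. K \<subseteq> L \<Longrightarrow> L \<subseteq> X \<Longrightarrow> conn E L \<Longrightarrow> L = K"
  using assms unfolding components_def by blast+

lemma Union_components: "\<Union>(components E X) = X"
proof (intro equalityI subsetI)
  fix v assume v: "v \<in> X"
  define \<Q> where "\<Q> = {Q. Q \<subseteq> X \<and> conn E Q \<and> v \<in> Q}"
  have ne: "{v} \<in> \<Q>" using v by (simp add: \<Q>_def conn_singleton)
  have "conn E (\<Union>\<Q>)"
    using conn_Union_common[of \<Q> E v] ne by (auto simp: \<Q>_def)
  moreover have "v \<in> \<Union>\<Q>" using ne by blast
  moreover have "\<Union>\<Q> \<subseteq> X" by (auto simp: \<Q>_def)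
  moreover have "L = \<Union>\<Q>" if "\<Union>\<Q> \<subseteq> L" "L \<subseteq> X" "conn E L" for L
  proof -
    have "L \<in> \<Q>" using that \<open>v \<in> \<Union>\<Q>\<close> by (auto simp: \<Q>_def)
    then show ?thesis using that by blast
  qed
  ultimately have "\<Union>\<Q> \<in> components E X" unfolding components_def by simp
  then show "v \<in> \<Union>(components E X)" using \<open>v \<in> \<Union>\<Q>\<close> by (rule UnionI)
qed (auto simp: components_def)

text \<open>Otherwise \<open>v\<close> could be added to \<open>K\<close>, against maximality.\<close>

lemma components_edge_closed:
  assumes K: "K \<in> components E X" and "u \<in> K" "v \<in> X" "{u, v} \<in> E"
  shows "v \<in> K"
proof -
  have "conn E (K \<union> {v})"
    using assms by (intro conn_Un_touching componentsD(2)[OF K] conn_singleton)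
      (auto simp: touching_def)
  then have "K \<union> {v} = K" using componentsD(1)[OF K] assms(3)
    by (intro componentsD(3)[OF K]) auto
  then show ?thesis by blast
qed

lemma components_absorb:
  assumes K: "K \<in> components E X" and L: "conn E L" "L \<subseteq> X" and v: "v \<in> K" "v \<in> L"
  shows "L \<subseteq> K"
  by (rule conn_subset_closed[OF L(1) v(2) v(1)])
    (use components_edge_closed[OF K] L(2) in blast)

lemma components_disjoint:
  assumes "K \<in> components E X" "L \<in> components E X" "K \<noteq> L"
  shows "K \<inter> L = {}"
  using assms components_absorb componentsD by (metis disjoint_iff subset_antisym)

section \<open>Small connectors and small edge cuts\<close>

lemma cheap_level:
  fixes f :: "nat \<Rightarrow> nat"
  assumes "1 \<le> r" "(\<Sum>j=1..r. f j) \<le> M"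
  shows "\<exists>j\<in>{1..r}. r * f j \<le> M"
proof (rule ccontr)
  assume *: "\<not> ?thesis"
  have "r * M < (\<Sum>j=1..r. r * f j)"
  proof -
    have "(\<Sum>j=1..r. M) < (\<Sum>j=1..r. r * f j)"
      using * assms(1) by (intro sum_strict_mono) (auto simp: not_le)
    then show ?thesis by simp
  qed
  also have "\<dots> = r * (\<Sum>j=1..r. f j)" by (simp add: sum_distrib_left)
  also have "\<dots> \<le> r * M" using assms(2) by simp
  finally show False by simp
qed

text \<open>
  For an index \<open>i\<close> and a size \<open>j\<close>, consider the set \<open>R i j\<close> of vertices that lie in a connected set
  of at most \<open>j\<close> vertices meeting the sets number \<open>0\<close> to \<open>i\<close>. Passing to a neighbour costs one more
  vertex. So the edges leaving \<open>R i j\<close> have both ends in \<open>R i (j + 1)\<close>, and for fixed \<open>i\<close> these edge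
  cuts are disjoint for different \<open>j\<close>. Averaging over \<open>j \<le> r\<close>, one level \<open>j\<close> has cuts of total size at
  most \<open>(length As - 1) * card E / r\<close> over all \<open>i\<close> except the last.

  These cuts suffice. A connected \<open>Q\<close> that avoids them lies inside or outside each \<open>R i j\<close>. If \<open>Q\<close>
  meets every set, then it contains a vertex of \<open>R 0 j\<close>, hence lies within it. A vertex of \<open>Q\<close> in the
  next set then belongs to \<open>R 1 j\<close> with the same witness, and so on. The last step yields a connected
  set of at most \<open>j\<close> vertices that meets all the sets.
\<close>

lemma small_connector_or_small_cut:
  assumes fin: "finite E" and ne: "As \<noteq> []" and r: "1 \<le> r"
    and none: "\<And>T. T \<subseteq> W \<Longrightarrow> conn E T \<Longrightarrow> finite T \<Longrightarrow> card T \<le> r \<Longrightarrow> \<exists>A\<in>set As. T \<inter> A = {}"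
  shows "\<exists>Z. Z \<subseteq> E \<and> r * card Z \<le> (length As - 1) * card E \<and>
    (\<forall>Q. Q \<subseteq> W \<and> conn (E - Z) Q \<longrightarrow> (\<exists>A\<in>set As. Q \<inter> A = {}))"
proof -
  define connector where "connector i j T \<longleftrightarrow>
    T \<subseteq> W \<and> conn E T \<and> finite T \<and> card T \<le> j \<and> (\<forall>l\<le>i. T \<inter> As ! l \<noteq> {})" for i j :: nat and T
  define R where "R i j = \<Union>{T. connector i j T}" for i j
  define cut where "cut i j = {e \<in> E. \<exists>u\<in>R i j. \<exists>v\<in>W - R i j. e = {u, v}}" for i j
  define n where "n = length As - 1"
  have R_mono: "R i j \<subseteq> R i j'" if "j \<le> j'" for i j j'
  proof -
    have "connector i j T \<Longrightarrow> connector i j' T" for T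
      using that by (simp add: connector_def)
    then show ?thesis unfolding R_def by blast
  qed
  have R_step: "v \<in> R i (Suc j)" if uv: "u \<in> R i j" "v \<in> W" "{u, v} \<in> E" for u v i j
  proof -
    obtain T where T: "connector i j T" "u \<in> T" using uv(1) unfolding R_def by blast
    have "touching E T {v}" using T(2) uv(3) unfolding touching_def by blast
    then have "conn E (T \<union> {v})"
      using T(1) by (intro conn_Un_touching conn_singleton) (simp_all add: connector_def)
    moreover have "card (T \<union> {v}) \<le> Suc j"
      using T(1) by (simp add: connector_def card_insert_if)
    moreover have "\<forall>l\<le>i. (T \<union> {v}) \<inter> As ! l \<noteq> {}"
      using T(1) unfolding connector_def by blast
    ultimately have "connector i (Suc j) (T \<union> {v})"
      using T(1) uv(2) by (simp add: connector_def)
    then show ?thesis unfolding R_def by blast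
  qed
  have disj: "cut i j \<inter> cut i j' = {}" if "j < j'" for i j j'
  proof (rule ccontr)
    assume "\<not> ?thesis"
    then obtain e where e: "e \<in> cut i j" "e \<in> cut i j'" by blast
    obtain u v where uv: "u \<in> R i j" "v \<in> W" "e = {u, v}" "e \<in> E"
      using e(1) unfolding cut_def by blast
    have "v \<in> R i (Suc j)" using R_step[OF uv(1,2)] uv(3,4) by simp
    moreover have "R i j \<subseteq> R i j'" "R i (Suc j) \<subseteq> R i j'" using \<open>j < j'\<close> by (simp_all add: R_mono)
    ultimately have "e \<subseteq> R i j'" using uv(1,3) by blast
    then show False using e(2) unfolding cut_def by blast
  qed
  have fin_cut: "finite (cut i j)" for i j using fin unfolding cut_def by simp
  have row: "(\<Sum>j=1..r. card (cut i j)) \<le> card E" for i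
  proof -
    have "(\<Sum>j=1..r. card (cut i j)) = card (\<Union>j\<in>{1..r}. cut i j)"
    proof (rule card_UN_disjoint[symmetric])
      show "\<forall>j\<in>{1..r}. \<forall>j'\<in>{1..r}. j \<noteq> j' \<longrightarrow> cut i j \<inter> cut i j' = {}"
        using disj by (metis Int_commute nat_neq_iff)
    qed (simp_all add: fin_cut)
    also have "\<dots> \<le> card E"
      by (rule card_mono[OF fin]) (simp add: cut_def UN_least)
    finally show ?thesis .
  qed
  have "(\<Sum>j=1..r. card (\<Union>i<n. cut i j)) \<le> (\<Sum>j=1..r. \<Sum>i<n. card (cut i j))"
    by (intro sum_mono card_UN_le) simp
  also have "\<dots> = (\<Sum>i<n. \<Sum>j=1..r. card (cut i j))" by (rule sum.swap)
  also have "\<dots> \<le> (\<Sum>i<n. card E)" by (intro sum_mono row)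
  also have "\<dots> = n * card E" by simp
  finally obtain j where j: "j \<in> {1..r}" "r * card (\<Union>i<n. cut i j) \<le> n * card E"
    using cheap_level[OF r, of "\<lambda>j. card (\<Union>i<n. cut i j)"] by blast
  define Z where "Z = (\<Union>i<n. cut i j)"
  have "\<exists>A\<in>set As. Q \<inter> A = {}" if Q: "Q \<subseteq> W" "conn (E - Z) Q" for Q
  proof (rule ccontr)
    assume all: "\<not> ?thesis"
    have meets: "\<exists>a. a \<in> Q \<and> a \<in> As ! i" if "i \<le> n" for i
    proof -
      have "i < length As" using that ne by (cases As) (auto simp: n_def)
      then have "As ! i \<in> set As" by simp
      then show ?thesis using all by blast
    qed
    have reach: "\<exists>a\<in>Q. a \<in> R i j" if "i \<le> n" for i
      using that
    proof (induction i)
      case 0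
      obtain a where a: "a \<in> Q" "a \<in> As ! 0" using meets[of 0] by blast
      have "connector 0 j {a}" using a Q(1) j(1) by (auto simp: connector_def conn_singleton)
      then show ?case using a(1) unfolding R_def by blast
    next
      case (Suc i)
      then obtain b where b: "b \<in> Q" "b \<in> R i j" by auto
      have "Q \<subseteq> R i j"
      proof (rule conn_subset_closed[OF Q(2) b])
        fix u v assume uv: "u \<in> R i j" "u \<in> Q" "v \<in> Q" "{u, v} \<in> E - Z"
        show "v \<in> R i j"
        proof (rule ccontr)
          assume "v \<notin> R i j"
          then have "{u, v} \<in> cut i j" using uv Q(1) unfolding cut_def by blast
          moreover have "i < n" using Suc.prems by simp
          ultimately show False using uv(4) unfolding Z_def by blast
        qed
      qed
      moreover obtain a where a: "a \<in> Q" "a \<in> As ! Suc i" using meets[OF Suc.prems] by blast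
      ultimately have "a \<in> R i j" by blast
      then obtain T where T: "connector i j T" "a \<in> T" unfolding R_def by blast
      have "\<forall>l\<le>Suc i. T \<inter> As ! l \<noteq> {}"
        using T a(2) unfolding connector_def le_Suc_eq by blast
      then have "connector (Suc i) j T" using T(1) by (simp add: connector_def)
      then show ?case using T(2) a(1) unfolding R_def by blast
    qed
    obtain T where T: "connector n j T"
      using reach[of n] unfolding R_def by blast
    then obtain A where A: "A \<in> set As" "T \<inter> A = {}"
      using none[of T] j(1) by (auto simp: connector_def)
    then obtain l where l: "l < length As" "As ! l = A" by (auto simp: in_set_conv_nth)
    then have "l \<le> n" by (simp add: n_def)
    then show False using T A(2) l(2) unfolding connector_def by blast
  qed
  moreover have "Z \<subseteq> E" by (auto simp: Z_def cut_def)
  moreover have "r * card Z \<le> (length As - 1) * card E" using j(2) by (simp add: Z_def n_def)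
  ultimately show ?thesis by (intro exI[of _ Z]) simp
qed

section \<open>Complete minors\<close>

text \<open>The vertices reached by paths from a fixed vertex form a closed set.\<close>

lemma conn_imp_connected_graph:
  assumes X: "conn (edges G) X" "X \<subseteq> verts G"
  shows "connected_graph (induced_subgraph G X)"
proof -
  let ?H = "induced_subgraph G X"
  have V: "verts ?H = X" using X(2) by (auto simp: induced_subgraph_def)
  have "\<exists>p. is_path ?H u p v" if uv: "u \<in> X" "v \<in> X" for u v
  proof -
    let ?S = "{v. \<exists>p. is_path ?H u p v}"
    have "X \<subseteq> ?S"
    proof (rule conn_subset_closed[OF X(1) uv(1)])
      have "is_path ?H u [u] u" using uv V by (auto simp: is_path_def)
      then show "u \<in> ?S" by blast
    next
      fix a b assume a: "a \<in> ?S" "a \<in> X" and b: "b \<in> X" "{a, b} \<in> edges G"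
      obtain p where p: "is_path ?H u p a" using a by blast
      show "b \<in> ?S"
      proof (cases "b \<in> set p")
        case True
        then obtain ys zs where "p = ys @ b # zs" by (meson split_list)
        then have "is_path ?H u (ys @ [b]) b"
          using p by (auto simp: is_path_def successively_append_iff hd_append)
        then show ?thesis by blast
      next
        case False
        then have "is_path ?H u (p @ [b]) b"
          using p a b V by (auto simp: is_path_def successively_append_iff induced_subgraph_def)
        then show ?thesis by blast
      qed
    qed
    then show ?thesis using uv by blast
  qed
  then show ?thesis using conn_nonempty[OF X(1)] V unfolding connected_graph_def by auto
qed

lemma complete_minorI:
  assumes fin: "finite \<B>" and card: "t \<le> card \<B>"
    and conn: "\<And>X. X \<in> \<B> \<Longrightarrow> X \<subseteq> verts G \<and> conn (edges G) X"
    and pair: "\<And>X Y. X \<in> \<B> \<Longrightarrow> Y \<in> \<B> \<Longrightarrow> X \<noteq> Y \<Longrightarrow> X \<inter> Y = {} \<and> touching (edges G) X Y"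
  shows "is_minor (complete_graph t) G"
proof -
  obtain f where f: "f ` {..<t} \<subseteq> \<B>" "inj_on f {..<t}"
    using card_le_inj[OF finite_lessThan fin, of t] card by auto
  have [simp]: "verts (complete_graph t) = {..<t}" by (simp add: complete_graph_def)
  have ne: "x \<noteq> y" if "{x, y} \<in> edges (complete_graph t)" for x y
    using that by (auto simp: complete_graph_def doubleton_eq_iff)
  have fne: "f x \<noteq> f y" if "x < t" "y < t" "x \<noteq> y" for x y
    using f(2) that by (auto simp: inj_on_def)
  have fB: "f x \<in> \<B>" if "x < t" for x using f that by auto
  show ?thesis unfolding is_minor_def
  proof (intro exI[of _ f] conjI ballI impI)
    fix x assume "x \<in> verts (complete_graph t)"
    then have "f x \<in> \<B>" using fB by simp
    then show "f x \<subseteq> verts G" "connected_graph (induced_subgraph G (f x))"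
      using conn conn_imp_connected_graph by blast+
  next
    fix x y assume "x \<in> verts (complete_graph t)" "y \<in> verts (complete_graph t)" "x \<noteq> y"
    then show "f x \<inter> f y = {}" using fB fne pair by simp
  next
    fix x y assume "x \<in> verts (complete_graph t)" "y \<in> verts (complete_graph t)"
      "{x, y} \<in> edges (complete_graph t)"
    then show "\<exists>u\<in>f x. \<exists>v\<in>f y. {u, v} \<in> edges G"
      using fB fne pair ne unfolding touching_def by simp
  qed
qed

section \<open>Growing a tree-decomposition leaf by leaf\<close>

definition add_leaf :: "'n ugraph \<Rightarrow> 'n \<Rightarrow> 'n \<Rightarrow> 'n ugraph" where
  "add_leaf T u n = Graph (insert n (verts T)) (insert {u, n} (edges T))"

lemma is_path_rev: "is_path G u p v \<Longrightarrow> is_path G v (rev p) u"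
  by (auto simp: is_path_def hd_rev last_rev successively_rev insert_commute)

lemma add_leaf_sel [simp]:
  "verts (add_leaf T u n) = insert n (verts T)" "edges (add_leaf T u n) = insert {u, n} (edges T)"
  by (simp_all add: add_leaf_def)

lemma is_path_add_leaf_avoiding:
  assumes "is_path (add_leaf T u n) a p b" "n \<notin> set p"
  shows "is_path T a p b"
proof -
  have "successively (\<lambda>x y. {x, y} \<in> edges T) p"
    by (rule successively_mono[of "\<lambda>x y. {x, y} \<in> edges (add_leaf T u n)"])
      (use assms in \<open>auto simp: is_path_def doubleton_eq_iff\<close>)
  then show ?thesis using assms by (auto simp: is_path_def)
qed

lemma add_leaf_neighbour:
  assumes "simple_graph T" "n \<notin> verts T" "{x, n} \<in> edges (add_leaf T u n)"
  shows "x = u"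
proof -
  have "{x, n} \<notin> edges T" using assms(1,2) by (auto simp: simple_graph_def)
  then have "{x, n} = {u, n}" using assms(3) by simp
  then show ?thesis by (auto simp: doubleton_eq_iff)
qed

lemma is_path_add_leaf_from:
  assumes "simple_graph T" "n \<notin> verts T" "is_path (add_leaf T u n) n (n # q) b" "q \<noteq> []"
  shows "is_path T u q b"
proof -
  obtain x xs where q: "q = x # xs" using assms(4) by (cases q) auto
  have "{x, n} \<in> edges (add_leaf T u n)"
    using assms(3) q by (simp add: is_path_def insert_commute)
  then have "x = u" by (rule add_leaf_neighbour[OF assms(1,2)])
  then have "is_path (add_leaf T u n) u q b"
    using assms(3) q by (simp add: is_path_def)
  moreover have "n \<notin> set q" using assms(3) by (simp add: is_path_def)
  ultimately show ?thesis by (rule is_path_add_leaf_avoiding)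
qed

text \<open>An inner vertex of a path has two distinct neighbours on it, but a leaf has only one.\<close>

lemma is_path_add_leaf_end:
  assumes T: "simple_graph T" "n \<notin> verts T" and p: "is_path (add_leaf T u n) a p b" and n: "n \<in> set p"
  shows "a = n \<or> b = n"
proof -
  obtain xs ys where xy: "p = xs @ n # ys" using n by (meson split_list)
  have "xs = [] \<or> ys = []"
  proof (rule ccontr)
    assume "\<not> ?thesis"
    then obtain xs' x y ys' where ne: "xs = xs' @ [x]" "ys = y # ys'"
      by (metis list.exhaust rev_exhaust)
    have succ: "successively (\<lambda>x y. {x, y} \<in> edges (add_leaf T u n)) p" and d: "distinct p"
      using p by (simp_all add: is_path_def)
    from succ have "{x, n} \<in> edges (add_leaf T u n)" "{y, n} \<in> edges (add_leaf T u n)"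
      unfolding xy ne by (simp_all add: successively_append_iff insert_commute)
    then have "x = u" "y = u" using add_leaf_neighbour[OF T] by blast+
    then show False using d unfolding xy ne by simp
  qed
  then show ?thesis using p unfolding xy is_path_def by auto
qed

lemma tree_add_leaf:
  assumes T: "tree T" and u: "u \<in> verts T" and n: "n \<notin> verts T"
  shows "tree (add_leaf T u n)"
proof -
  have sT: "simple_graph T" and cT: "connected_graph T" and aT: "acyclic_graph T"
    using T by (auto simp: tree_def)
  have un: "u \<noteq> n" using u n by blast
  have simple: "simple_graph (add_leaf T u n)"
    using sT u un by (auto simp: simple_graph_def)
  have lift: "is_path (add_leaf T u n) a p b" if "is_path T a p b" for a p b
    using that by (auto simp: is_path_def intro: successively_mono)
  have from_n: "\<exists>p. is_path (add_leaf T u n) n p b" if b: "b \<in> verts T" for b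
  proof -
    obtain p where p: "is_path T u p b" using cT u b by (auto simp: connected_graph_def)
    then have "is_path (add_leaf T u n) n (n # p) b"
      using lift[OF p] n by (cases p) (auto simp: is_path_def insert_commute)
    then show ?thesis by blast
  qed
  have n_n: "is_path (add_leaf T u n) n [n] n" by (auto simp: is_path_def)
  have connected: "connected_graph (add_leaf T u n)"
    unfolding connected_graph_def
  proof (intro conjI ballI)
    show "verts (add_leaf T u n) \<noteq> {}" by simp
    fix a b assume ab: "a \<in> verts (add_leaf T u n)" "b \<in> verts (add_leaf T u n)"
    show "\<exists>p. is_path (add_leaf T u n) a p b"
    proof (cases "a = n \<or> b = n")
      case True
      then show ?thesis using ab from_n n_n is_path_rev[of "add_leaf T u n"]
        by (metis add_leaf_sel(1) insertE)
    next
      case False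
      then show ?thesis using ab cT lift unfolding connected_graph_def by (metis add_leaf_sel(1) insertE)
    qed
  qed
  have no_cycle_n: False
    if p: "is_path (add_leaf T u n) n p b" "3 \<le> length p" "{b, n} \<in> edges (add_leaf T u n)" for p b
  proof -
    obtain q where q: "p = n # q" using p(1) by (cases p) (simp_all add: is_path_def)
    have q2: "q \<noteq> []" "length q \<ge> 2" using p(2) q by auto
    have "is_path T u q b" using is_path_add_leaf_from[OF sT n] p(1) q q2(1) by blast
    moreover have "b = u" using p(3) by (rule add_leaf_neighbour[OF sT n])
    ultimately have "hd q = last q" "distinct q" by (auto simp: is_path_def)
    then show False using q2 by (cases q) (auto split: if_splits)
  qed
  have "acyclic_graph (add_leaf T u n)"
    unfolding acyclic_graph_def
  proof (intro notI, elim exE conjE)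
    fix a p b assume p: "is_path (add_leaf T u n) a p b" "3 \<le> length p" "{b, a} \<in> edges (add_leaf T u n)"
    show False
    proof (cases "n \<in> set p")
      case True
      then have "a = n \<or> b = n" using is_path_add_leaf_end[OF sT n p(1)] by blast
      then show False
        using no_cycle_n[of p b] no_cycle_n[of "rev p" a] is_path_rev[OF p(1)] p
        by (auto simp: insert_commute)
    next
      case False
      have "a \<noteq> n" "b \<noteq> n" using p(1) False by (auto simp: is_path_def)
      then have "{b, a} \<in> edges T" using p(3) by (auto simp: doubleton_eq_iff)
      then show False using aT is_path_add_leaf_avoiding[OF p(1) False] p(2)
        by (auto simp: acyclic_graph_def)
    qed
  qed
  then show ?thesis using simple connected by (simp add: tree_def)
qed

text \<open>
  The stages of the construction: a tree-decomposition with bags of size at most \<open>N\<close>, except that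
  it need not yet cover the vertices and edges of any particular graph.
\<close>

definition partial_decomposition :: "nat \<Rightarrow> 'n ugraph \<Rightarrow> ('n \<Rightarrow> 'b set) \<Rightarrow> bool" where
  "partial_decomposition N T B \<longleftrightarrow> tree T \<and>
     (\<forall>u\<^sub>1 p u\<^sub>3. is_path T u\<^sub>1 p u\<^sub>3 \<longrightarrow> (\<forall>u\<^sub>2\<in>set p. B u\<^sub>1 \<inter> B u\<^sub>3 \<subseteq> B u\<^sub>2)) \<and>
     (\<forall>x\<in>verts T. finite (B x) \<and> card (B x) \<le> N)"

definition covered :: "'n ugraph \<Rightarrow> ('n \<Rightarrow> 'b set) \<Rightarrow> 'b set" where
  "covered T B = (\<Union>x\<in>verts T. B x)"

definition extends :: "'n ugraph \<Rightarrow> ('n \<Rightarrow> 'b set) \<Rightarrow> 'n ugraph \<Rightarrow> ('n \<Rightarrow> 'b set) \<Rightarrow> bool" where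
  "extends T B T' B' \<longleftrightarrow> verts T \<subseteq> verts T' \<and> (\<forall>x\<in>verts T. B' x = B x)"

text \<open>
  Whatever the new bag shares with an old one lies in the bag of the attachment node \<open>u\<close>, and every
  path from the leaf runs through \<open>u\<close>. So the path condition for the new bag reduces to the one for
  paths from \<open>u\<close>.
\<close>

lemma partial_decomposition_add_leaf:
  assumes pd: "partial_decomposition N T B" and u: "u \<in> verts T" and n: "n \<notin> verts T"
    and R: "finite R" "card R \<le> N" "covered T B \<inter> R \<subseteq> B u"
  shows "partial_decomposition N (add_leaf T u n) (B(n := R))"
proof -
  have tT: "tree T" and sT: "simple_graph T"
    and old: "\<And>a p b x. is_path T a p b \<Longrightarrow> x \<in> set p \<Longrightarrow> B a \<inter> B b \<subseteq> B x"
    using pd by (auto simp: partial_decomposition_def tree_def)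
  let ?T = "add_leaf T u n" and ?B = "B(n := R)"
  have inT: "set p \<subseteq> verts T \<and> a \<in> verts T \<and> b \<in> verts T" if "is_path T a p b" for a p b
    using that by (auto simp: is_path_def)
  have from_n: "R \<inter> ?B b \<subseteq> ?B x" if p: "is_path ?T n p b" "x \<in> set p" for p b x
  proof (cases "x = n")
    case False
    obtain q where q: "p = n # q" using p(1) by (cases p) (simp_all add: is_path_def)
    have x: "x \<in> set q" "q \<noteq> []" using p(2) False q by auto
    then have path: "is_path T u q b" using is_path_add_leaf_from[OF sT n] p(1) q x(2) by blast
    then have b: "b \<in> verts T" "b \<noteq> n" using inT n by blast+
    then have "R \<inter> B b \<subseteq> B u \<inter> B b" using R(3) by (auto simp: covered_def)
    also have "\<dots> \<subseteq> B x" using old[OF path x(1)] .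
    finally show ?thesis using b False by simp
  qed simp
  have "?B a \<inter> ?B b \<subseteq> ?B x" if p: "is_path ?T a p b" "x \<in> set p" for a p b x
  proof (cases "n \<in> set p")
    case True
    then have "a = n \<or> b = n" using is_path_add_leaf_end[OF sT n p(1)] by blast
    then show ?thesis
      using from_n[of p b x] from_n[of "rev p" a x] is_path_rev[OF p(1)] p by auto
  next
    case False
    then have "is_path T a p b" using is_path_add_leaf_avoiding p by fast
    then show ?thesis using old[of a p b x] p inT[of a p b] n by auto
  qed
  then show ?thesis using tree_add_leaf[OF tT u n] pd R
    by (auto simp: partial_decomposition_def)
qed

section \<open>Decomposing a region through its subregions\<close>

definition edges_meeting :: "'a set set \<Rightarrow> 'a set \<Rightarrow> 'a set set" where
  "edges_meeting E X = {e \<in> E. e \<inter> X \<noteq> {}}"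

definition boundary :: "'a set set \<Rightarrow> 'a set \<Rightarrow> 'a set set" where
  "boundary E X = {e \<in> E. e \<inter> X \<noteq> {} \<and> \<not> e \<subseteq> X}"

definition edges_between :: "'a set set \<Rightarrow> 'a set \<Rightarrow> 'a set \<Rightarrow> 'a set set" where
  "edges_between E X Y = {e \<in> E. e \<inter> X \<noteq> {} \<and> e \<inter> Y \<noteq> {}}"

text \<open>
  A region is extendable if the edges meeting it can be added to any partial decomposition in which
  some bag contains its boundary and no other edge meeting it has been used before. The given part
  is kept unchanged. What is gained is a bag containing all edges at \<open>v\<close>, for every vertex \<open>v\<close>
  of the region. Since the given decomposition is arbitrary, subregions can be treated one after
  the other.
\<close>

definition extendable :: "'a set set \<Rightarrow> nat \<Rightarrow> 'a set \<Rightarrow> bool" where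
  "extendable E N W \<longleftrightarrow> (\<forall>(T :: nat ugraph) B u.
     partial_decomposition N T B \<and> u \<in> verts T \<and> boundary E W \<subseteq> B u \<and>
     covered T B \<inter> edges_meeting E W \<subseteq> boundary E W \<longrightarrow>
     (\<exists>(T' :: nat ugraph) B'. partial_decomposition N T' B' \<and> extends T B T' B' \<and>
        covered T' B' \<subseteq> covered T B \<union> edges_meeting E W \<and>
        (\<forall>v\<in>W. \<exists>x\<in>verts T'. edges_meeting E {v} \<subseteq> B' x)))"

text \<open>
  Disjoint regions do not interfere: an edge that meets two of them belongs to the boundary of both,
  so after one region has been handled, the hypotheses for the next one still hold.
\<close>

lemma extend_family:
  fixes T :: "nat ugraph"
  assumes "finite \<W>" and "\<And>X. X \<in> \<W> \<Longrightarrow> extendable E N X"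
    and "\<And>X Y. X \<in> \<W> \<Longrightarrow> Y \<in> \<W> \<Longrightarrow> X \<noteq> Y \<Longrightarrow> X \<inter> Y = {}"
    and "partial_decomposition N T B" "u \<in> verts T"
    and "\<And>X. X \<in> \<W> \<Longrightarrow> boundary E X \<subseteq> B u"
    and "\<And>X. X \<in> \<W> \<Longrightarrow> covered T B \<inter> edges_meeting E X \<subseteq> boundary E X"
  shows "\<exists>(T' :: nat ugraph) B'. partial_decomposition N T' B' \<and> extends T B T' B' \<and>
     covered T' B' \<subseteq> covered T B \<union> edges_meeting E (\<Union>\<W>) \<and>
     (\<forall>v\<in>\<Union>\<W>. \<exists>x\<in>verts T'. edges_meeting E {v} \<subseteq> B' x)"
  using assms
proof (induction \<W> rule: finite_induct)
  case empty
  then show ?case by (intro exI[of _ T] exI[of _ B]) (auto simp: extends_def)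
next
  case (insert X \<W>)
  have "\<exists>(T1 :: nat ugraph) B1. partial_decomposition N T1 B1 \<and> extends T B T1 B1 \<and>
     covered T1 B1 \<subseteq> covered T B \<union> edges_meeting E (\<Union>\<W>) \<and>
     (\<forall>v\<in>\<Union>\<W>. \<exists>x\<in>verts T1. edges_meeting E {v} \<subseteq> B1 x)"
    by (rule insert.IH) (use insert.prems in simp_all)
  then obtain T1 :: "nat ugraph" and B1 where 1: "partial_decomposition N T1 B1" "extends T B T1 B1"
    "covered T1 B1 \<subseteq> covered T B \<union> edges_meeting E (\<Union>\<W>)"
    "\<forall>v\<in>\<Union>\<W>. \<exists>x\<in>verts T1. edges_meeting E {v} \<subseteq> B1 x"
    by blast
  have disj: "X \<inter> Y = {}" if "Y \<in> \<W>" for Y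
    using insert.prems(2)[of X Y] that insert.hyps by auto
  have "u \<in> verts T1" "boundary E X \<subseteq> B1 u"
    using 1(2) insert.prems(4) insert.prems(5)[of X] by (auto simp: extends_def)
  moreover have "covered T1 B1 \<inter> edges_meeting E X \<subseteq> boundary E X"
  proof -
    have "edges_meeting E (\<Union>\<W>) \<inter> edges_meeting E X \<subseteq> boundary E X"
      using disj by (fastforce simp: edges_meeting_def boundary_def)
    then show ?thesis using 1(3) insert.prems(6)[of X] by blast
  qed
  ultimately obtain T2 :: "nat ugraph" and B2 where 2: "partial_decomposition N T2 B2" "extends T1 B1 T2 B2"
    "covered T2 B2 \<subseteq> covered T1 B1 \<union> edges_meeting E X"
    "\<forall>v\<in>X. \<exists>x\<in>verts T2. edges_meeting E {v} \<subseteq> B2 x"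
    using insert.prems(1)[of X] 1(1) unfolding extendable_def by blast
  have "extends T B T2 B2" using 1(2) 2(2) by (auto simp: extends_def)
  moreover have "covered T2 B2 \<subseteq> covered T B \<union> edges_meeting E (\<Union>(insert X \<W>))"
    using 1(3) 2(3) by (auto simp: edges_meeting_def)
  moreover have "\<exists>x\<in>verts T2. edges_meeting E {v} \<subseteq> B2 x" if "v \<in> \<Union>(insert X \<W>)" for v
  proof (cases "v \<in> X")
    case False
    then have "v \<in> \<Union>\<W>" using that by blast
    then obtain x where "x \<in> verts T1" "edges_meeting E {v} \<subseteq> B1 x" using 1(4) by blast
    moreover have "x \<in> verts T2" "B2 x = B1 x" using 2(2) \<open>x \<in> verts T1\<close> by (auto simp: extends_def)
    ultimately show ?thesis by auto
  qed (use 2(4) in blast)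
  ultimately show ?case using 2(1) by blast
qed

text \<open>
  One step of the recursion: a leaf with bag \<open>R\<close> is attached, the subregions \<open>\<W>\<close> are hung below it,
  and the vertices outside the subregions are already served by \<open>R\<close>.
\<close>

lemma extendable_split:
  assumes R: "boundary E W \<subseteq> R" "R \<subseteq> edges_meeting E W" "finite R" "card R \<le> N"
    and \<W>: "finite \<W>" "\<And>X. X \<in> \<W> \<Longrightarrow> X \<subseteq> W" "\<And>X. X \<in> \<W> \<Longrightarrow> extendable E N X"
      "\<And>X Y. X \<in> \<W> \<Longrightarrow> Y \<in> \<W> \<Longrightarrow> X \<noteq> Y \<Longrightarrow> X \<inter> Y = {}"
    and bd: "\<And>X. X \<in> \<W> \<Longrightarrow> boundary E X \<subseteq> R" "\<And>X. X \<in> \<W> \<Longrightarrow> R \<inter> edges_meeting E X \<subseteq> boundary E X"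
    and rest: "\<And>v. v \<in> W - \<Union>\<W> \<Longrightarrow> edges_meeting E {v} \<subseteq> R"
  shows "extendable E N W"
  unfolding extendable_def
proof (intro allI impI, elim conjE)
  fix T :: "nat ugraph" and B u
  assume pd: "partial_decomposition N T B" and u: "u \<in> verts T" and bu: "boundary E W \<subseteq> B u"
    and cov: "covered T B \<inter> edges_meeting E W \<subseteq> boundary E W"
  have "finite (verts T)" using pd by (auto simp: partial_decomposition_def tree_def simple_graph_def)
  then obtain n where n: "n \<notin> verts T" using ex_new_if_finite infinite_UNIV_nat by blast
  let ?T = "add_leaf T u n" and ?B = "B(n := R)"
  have pd': "partial_decomposition N ?T ?B"
    using partial_decomposition_add_leaf[OF pd u n R(3,4)] R(2) bu cov by blast
  have cov': "covered ?T ?B = covered T B \<union> R" using n by (auto simp: covered_def)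
  have sub: "covered ?T ?B \<inter> edges_meeting E X \<subseteq> boundary E X" if X: "X \<in> \<W>" for X
  proof -
    have "edges_meeting E X \<subseteq> edges_meeting E W" using \<W>(2)[OF X] by (auto simp: edges_meeting_def)
    then show ?thesis using cov' cov R(1) bd(2)[OF X] by blast
  qed
  obtain T' :: "nat ugraph" and B' where T': "partial_decomposition N T' B'" "extends ?T ?B T' B'"
    "covered T' B' \<subseteq> covered ?T ?B \<union> edges_meeting E (\<Union>\<W>)"
    "\<forall>v\<in>\<Union>\<W>. \<exists>x\<in>verts T'. edges_meeting E {v} \<subseteq> B' x"
    using extend_family[OF \<W>(1,3,4) pd', of n] bd(1) sub by auto
  have "extends T B T' B'" using T'(2) n by (auto simp: extends_def)
  moreover have "covered T' B' \<subseteq> covered T B \<union> edges_meeting E W"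
  proof -
    have "edges_meeting E (\<Union>\<W>) \<subseteq> edges_meeting E W" using \<W>(2) by (fastforce simp: edges_meeting_def)
    then show ?thesis using T'(3) cov' R(2) by blast
  qed
  moreover have "\<exists>x\<in>verts T'. edges_meeting E {v} \<subseteq> B' x" if "v \<in> W" for v
  proof (cases "v \<in> \<Union>\<W>")
    case False
    then have "edges_meeting E {v} \<subseteq> R" using rest that by blast
    then show ?thesis using T'(2) by (intro bexI[of _ n]) (auto simp: extends_def)
  qed (use T'(4) in blast)
  ultimately show "\<exists>(T' :: nat ugraph) B'. partial_decomposition N T' B' \<and> extends T B T' B' \<and>
        covered T' B' \<subseteq> covered T B \<union> edges_meeting E W \<and>
        (\<forall>v\<in>W. \<exists>x\<in>verts T'. edges_meeting E {v} \<subseteq> B' x)"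
    using T'(1) by blast
qed

section \<open>Regions surrounded by a clique model\<close>

lemma edges_meeting_Union: "edges_meeting E X = (\<Union>v\<in>X. edges_meeting E {v})"
  by (auto simp: edges_meeting_def)

lemma simple_graph_edgeE:
  assumes "simple_graph G" "e \<in> edges G"
  obtains a b where "e = {a, b}" "a \<noteq> b" "a \<in> verts G" "b \<in> verts G"
proof -
  have "card e = 2" "e \<subseteq> verts G" using assms by (auto simp: simple_graph_def)
  then show thesis using that by (auto simp: card_2_iff)
qed

lemma simple_graph_finite_edges: "simple_graph G \<Longrightarrow> finite (edges G)"
  by (rule finite_subset[of _ "Pow (verts G)"]) (auto simp: simple_graph_def)

lemma edge_endsE:
  assumes "simple_graph G" "e \<in> edges G" "e \<inter> X \<noteq> {}" "\<not> e \<subseteq> X"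
  obtains a b where "e = {a, b}" "a \<in> X" "b \<notin> X"
proof -
  obtain a b where "e = {a, b}" using simple_graph_edgeE[OF assms(1,2)] by metis
  then show thesis using that[of a b] that[of b a] assms(3,4) by (auto simp: insert_commute)
qed

lemma boundaryE:
  assumes "simple_graph G" "e \<in> boundary (edges G) X"
  obtains a b where "e = {a, b}" "a \<in> X" "b \<notin> X"
  using assms edge_endsE[of G e X] by (auto simp: boundary_def)

text \<open>
  The invariant of the recursion. The sets in \<open>\<C>\<close> and \<open>W\<close> are the branch sets of a model of a
  complete graph with \<open>card \<C> + 1\<close> vertices, and \<open>\<C>\<close> accounts for all edges leaving \<open>W\<close>, with at
  most \<open>k\<close> for each member.
\<close>

definition clique_region :: "'a ugraph \<Rightarrow> nat \<Rightarrow> 'a set set \<Rightarrow> 'a set \<Rightarrow> bool" where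
  "clique_region G k \<C> W \<longleftrightarrow> W \<subseteq> verts G \<and> conn (edges G) W \<and> finite \<C> \<and>
     (\<forall>C\<in>\<C>. C \<subseteq> verts G \<and> conn (edges G) C \<and> C \<inter> W = {} \<and> touching (edges G) C W \<and>
        card (edges_between (edges G) C W) \<le> k) \<and>
     (\<forall>C\<in>\<C>. \<forall>D\<in>\<C>. C \<noteq> D \<longrightarrow> C \<inter> D = {} \<and> touching (edges G) C D) \<and>
     boundary (edges G) W \<subseteq> (\<Union>C\<in>\<C>. edges_between (edges G) C W)"

lemma clique_regionD:
  assumes "clique_region G k \<C> W"
  shows "W \<subseteq> verts G" "conn (edges G) W" "finite \<C>"
    and "\<And>C. C \<in> \<C> \<Longrightarrow> C \<subseteq> verts G \<and> conn (edges G) C \<and> C \<inter> W = {} \<and>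
        touching (edges G) C W \<and> card (edges_between (edges G) C W) \<le> k"
    and "\<And>C D. C \<in> \<C> \<Longrightarrow> D \<in> \<C> \<Longrightarrow> C \<noteq> D \<Longrightarrow> C \<inter> D = {} \<and> touching (edges G) C D"
    and "boundary (edges G) W \<subseteq> (\<Union>C\<in>\<C>. edges_between (edges G) C W)"
  using assms by (simp_all add: clique_region_def)

text \<open>
  When a region shrinks, some of the surrounding sets may lose contact with it. They send no edges
  into it, so they can be dropped.
\<close>

lemma clique_region_restrict:
  assumes G: "simple_graph G" and W: "W \<subseteq> verts G" "conn (edges G) W" and fin: "finite \<C>"
    and C: "\<And>C. C \<in> \<C> \<Longrightarrow> C \<subseteq> verts G \<and> conn (edges G) C \<and> C \<inter> W = {} \<and>
        card (edges_between (edges G) C W) \<le> k"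
    and pair: "\<And>C D. C \<in> \<C> \<Longrightarrow> D \<in> \<C> \<Longrightarrow> C \<noteq> D \<Longrightarrow> C \<inter> D = {} \<and> touching (edges G) C D"
    and bd: "boundary (edges G) W \<subseteq> (\<Union>C\<in>\<C>. edges_between (edges G) C W)"
  shows "clique_region G k {C \<in> \<C>. touching (edges G) C W} W"
proof -
  have "e \<in> (\<Union>C\<in>{C \<in> \<C>. touching (edges G) C W}. edges_between (edges G) C W)"
    if e: "e \<in> boundary (edges G) W" for e
  proof -
    obtain D where D: "D \<in> \<C>" "e \<in> edges_between (edges G) D W" using bd e by blast
    have "e \<in> edges G" using e by (simp add: boundary_def)
    then obtain a b where ab: "e = {a, b}" by (rule simple_graph_edgeE[OF G])
    have disj: "D \<inter> W = {}" using C[OF D(1)] by blast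
    have eE: "{a, b} \<in> edges G" "{b, a} \<in> edges G"
      using e unfolding boundary_def ab by (simp_all add: insert_commute)
    have "(a \<in> D \<and> b \<in> W) \<or> (b \<in> D \<and> a \<in> W)"
      using D(2) disj unfolding edges_between_def ab by blast
    then have "touching (edges G) D W" using eE unfolding touching_def by blast
    then show ?thesis using D by blast
  qed
  then have "boundary (edges G) W \<subseteq> (\<Union>C\<in>{C \<in> \<C>. touching (edges G) C W}. edges_between (edges G) C W)"
    by (rule subsetI)
  then show ?thesis using W fin C pair by (simp add: clique_region_def)
qed

lemma clique_region_card:
  assumes "clique_region G k \<C> W" "\<not> is_minor (complete_graph t) G"
  shows "card \<C> + 2 \<le> t"
proof (rule ccontr)
  assume many: "\<not> ?thesis"
  note W = clique_regionD(1,2)[OF assms(1)] and fin = clique_regionD(3)[OF assms(1)]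
    and C = clique_regionD(4)[OF assms(1)] and pair = clique_regionD(5)[OF assms(1)]
  have "W \<notin> \<C>" using C conn_nonempty[OF W(2)] by blast
  then have "t \<le> card (insert W \<C>)" using fin many by simp
  moreover have "X \<subseteq> verts G \<and> conn (edges G) X" if "X \<in> insert W \<C>" for X
    using that W C by blast
  moreover have "X \<inter> Y = {} \<and> touching (edges G) X Y"
    if "X \<in> insert W \<C>" "Y \<in> insert W \<C>" "X \<noteq> Y" for X Y
    using that C[of X] C[of Y] pair[of X Y] touching_sym[of "edges G" Y X] by blast
  ultimately have "is_minor (complete_graph t) G"
    using complete_minorI[of "insert W \<C>" t G] fin by blast
  then show False using assms(2) by blast
qed

lemma clique_region_boundary_card:
  assumes "clique_region G k \<C> W" "finite (edges G)"
  shows "card (boundary (edges G) W) \<le> card \<C> * k"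
proof -
  note fin = clique_regionD(3)[OF assms(1)] and bd = clique_regionD(6)[OF assms(1)]
  have C: "card (edges_between (edges G) C W) \<le> k" if "C \<in> \<C>" for C
    using clique_regionD(4)[OF assms(1) that] by blast
  have "card (boundary (edges G) W) \<le> card (\<Union>C\<in>\<C>. edges_between (edges G) C W)"
    using bd fin assms(2) by (intro card_mono) (auto simp: edges_between_def)
  also have "\<dots> \<le> (\<Sum>C\<in>\<C>. card (edges_between (edges G) C W))" by (rule card_UN_le[OF fin])
  also have "\<dots> \<le> (\<Sum>C\<in>\<C>. k)" by (intro sum_mono C)
  finally show ?thesis by simp
qed

lemma clique_region_bag_card:
  assumes "clique_region G k \<C> W" "simple_graph G" "\<not> is_minor (complete_graph t) G"
    and "R \<subseteq> boundary (edges G) W \<union> Y" "Y \<subseteq> edges G" "card Y \<le> k"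
  shows "finite R" "card R \<le> (t - 1) * k"
proof -
  have fin: "finite (boundary (edges G) W \<union> Y)"
    by (rule finite_subset[OF _ simple_graph_finite_edges[OF assms(2)]])
      (use assms(5) in \<open>auto simp: boundary_def\<close>)
  then show "finite R" using assms(4) finite_subset by blast
  have "card R \<le> card (boundary (edges G) W) + card Y"
    using card_mono[OF fin assms(4)] card_Un_le[of "boundary (edges G) W" Y] by linarith
  also have "\<dots> \<le> (card \<C> + 1) * k"
    using clique_region_boundary_card[OF assms(1) simple_graph_finite_edges[OF assms(2)]] assms(6) by simp
  also have "\<dots> \<le> (t - 1) * k"
    using clique_region_card[OF assms(1,3)] by (intro mult_right_mono) auto
  finally show "card R \<le> (t - 1) * k" .
qed

text \<open>
  The bag consists of the boundary of \<open>W\<close> and the edges meeting \<open>T\<close>. An edge leaving a component of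
  \<open>W - T\<close> ends in \<open>T\<close> or outside \<open>W\<close>, hence in \<open>T\<close> or a member of \<open>\<C>\<close>, and it lies in the bag.
\<close>

lemma extendable_by_connector:
  assumes G: "simple_graph G" "\<not> is_minor (complete_graph t) G"
    and reg: "clique_region G k \<C> W"
    and T: "T \<subseteq> W" "conn (edges G) T" "card (edges_meeting (edges G) T) \<le> k"
      "\<And>C. C \<in> \<C> \<Longrightarrow> touching (edges G) C T"
    and IH: "\<And>\<C>' W'. W' \<subset> W \<Longrightarrow> clique_region G k \<C>' W' \<Longrightarrow> extendable (edges G) N W'"
    and N: "N = (t - 1) * k"
  shows "extendable (edges G) N W"
proof -
  let ?E = "edges G"
  define R where "R = boundary ?E W \<union> edges_meeting ?E T"
  define \<W> where "\<W> = components ?E (W - T)"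
  have finE: "finite ?E" using G(1) by (rule simple_graph_finite_edges)
  note W = clique_regionD(1,2)[OF reg] and fin = clique_regionD(3)[OF reg]
    and C = clique_regionD(4)[OF reg] and pair = clique_regionD(5)[OF reg] and bd = clique_regionD(6)[OF reg]
  have finW: "finite W" using W(1) G(1) finite_subset by (auto simp: simple_graph_def)
  have sub: "K \<subseteq> W - T" if "K \<in> \<W>" for K using that componentsD unfolding \<W>_def by blast
  have ends: "\<exists>a b. e = {a, b} \<and> a \<in> K \<and> (b \<in> T \<or> b \<notin> W)" if K: "K \<in> \<W>" and e: "e \<in> boundary ?E K" for K e
  proof -
    obtain a b where ab: "e = {a, b}" "a \<in> K" "b \<notin> K"
      by (rule boundaryE[OF G(1) e])
    have "{a, b} \<in> ?E" using e ab(1) by (simp add: boundary_def)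
    then have "b \<notin> W - T" using components_edge_closed[of K ?E "W - T" a b] K ab unfolding \<W>_def by blast
    then show ?thesis using ab by blast
  qed
  have R1: "boundary ?E W \<subseteq> R" "R \<subseteq> edges_meeting ?E W"
    using T(1) by (auto simp: R_def boundary_def edges_meeting_def)
  have R2: "finite R" "card R \<le> N"
    using clique_region_bag_card[OF reg G, of R "edges_meeting ?E T"] T(3) N
    by (auto simp: R_def edges_meeting_def)
  have "finite \<W>" by (rule finite_subset[of _ "Pow W"]) (use sub finW in auto)
  moreover have "extendable ?E N K" if K: "K \<in> \<W>" for K
  proof (rule IH)
    show "K \<subset> W" using sub[OF K] T(1) conn_nonempty[OF T(2)] by blast
    show "clique_region G k {C \<in> insert T \<C>. touching ?E C K} K"
    proof (rule clique_region_restrict[OF G(1)])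
      show "K \<subseteq> verts G" using sub[OF K] W(1) by blast
      show "conn ?E K" using K componentsD(2) unfolding \<W>_def by blast
      show "finite (insert T \<C>)" using fin by simp
    next
      fix C assume C': "C \<in> insert T \<C>"
      have "card (edges_between ?E C K) \<le> k"
      proof (cases "C = T")
        case True
        have "edges_between ?E T K \<subseteq> edges_meeting ?E T" by (auto simp: edges_between_def edges_meeting_def)
        then have "card (edges_between ?E T K) \<le> card (edges_meeting ?E T)"
          using finE by (intro card_mono) (auto simp: edges_meeting_def)
        then show ?thesis using T(3) True by simp
      next
        case False
        have "edges_between ?E C K \<subseteq> edges_between ?E C W"
          using sub[OF K] by (auto simp: edges_between_def)
        then have "card (edges_between ?E C K) \<le> card (edges_between ?E C W)"
          using finE by (intro card_mono) (auto simp: edges_between_def)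
        then show ?thesis using C[of C] C' False by auto
      qed
      moreover have "C \<subseteq> verts G \<and> conn ?E C \<and> C \<inter> K = {}"
        using C' C[of C] T(1,2) W(1) sub[OF K] by blast
      ultimately show "C \<subseteq> verts G \<and> conn ?E C \<and> C \<inter> K = {} \<and> card (edges_between ?E C K) \<le> k"
        by blast
    next
      fix C D assume CD: "C \<in> insert T \<C>" "D \<in> insert T \<C>" "C \<noteq> D"
      show "C \<inter> D = {} \<and> touching ?E C D"
      proof (cases "C = T \<or> D = T")
        case True
        then obtain X where X: "X \<in> \<C>" "C = T \<and> D = X \<or> C = X \<and> D = T" using CD by blast
        have "X \<inter> T = {}" "touching ?E X T" using C[OF X(1)] T(1) T(4)[OF X(1)] by blast+
        then show ?thesis using X(2) touching_sym[of ?E X T] by blast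
      qed (use CD pair in blast)
    next
      show "boundary ?E K \<subseteq> (\<Union>C\<in>insert T \<C>. edges_between ?E C K)"
      proof
        fix e assume e: "e \<in> boundary ?E K"
        obtain a b where ab: "e = {a, b}" "a \<in> K" "b \<in> T \<or> b \<notin> W" using ends[OF K e] by blast
        have eE: "e \<in> ?E" using e by (simp add: boundary_def)
        show "e \<in> (\<Union>C\<in>insert T \<C>. edges_between ?E C K)"
        proof (cases "b \<in> T")
          case True
          then show ?thesis using eE ab by (auto simp: edges_between_def)
        next
          case False
          then have "e \<in> boundary ?E W" using ab eE sub[OF K] by (auto simp: boundary_def)
          then obtain C where C': "C \<in> \<C>" "e \<inter> C \<noteq> {}" using bd unfolding edges_between_def by blast
          then show ?thesis using eE ab by (auto simp: edges_between_def)
        qed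
      qed
    qed
  qed
  moreover have "K \<inter> L = {}" if "K \<in> \<W>" "L \<in> \<W>" "K \<noteq> L" for K L
    using that components_disjoint unfolding \<W>_def by blast
  moreover have "boundary ?E K \<subseteq> R" if K: "K \<in> \<W>" for K
  proof
    fix e assume e: "e \<in> boundary ?E K"
    obtain a b where ab: "e = {a, b}" "a \<in> K" "b \<in> T \<or> b \<notin> W" using ends[OF K e] by blast
    have "e \<in> ?E" using e by (simp add: boundary_def)
    then show "e \<in> R" using ab sub[OF K] by (auto simp: R_def boundary_def edges_meeting_def)
  qed
  moreover have "R \<inter> edges_meeting ?E K \<subseteq> boundary ?E K" if K: "K \<in> \<W>" for K
    using sub[OF K] by (auto simp: R_def boundary_def edges_meeting_def)
  moreover have "edges_meeting ?E {v} \<subseteq> R" if "v \<in> W - \<Union>\<W>" for v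
  proof -
    have "v \<in> T" using that Union_components[of ?E "W - T"] unfolding \<W>_def by blast
    then show ?thesis by (auto simp: R_def edges_meeting_def)
  qed
  moreover have "K \<subseteq> W" if "K \<in> \<W>" for K using sub[OF that] by blast
  ultimately show ?thesis by (intro extendable_split[OF R1 R2, of \<W>])
qed

text \<open>
  Speaking of all connected \<open>Q\<close> instead of the components left by \<open>Z\<close> makes it easy to compare
  different sets \<open>Z\<close>.
\<close>

definition separating :: "'a ugraph \<Rightarrow> 'a set set \<Rightarrow> 'a set \<Rightarrow> 'a set set \<Rightarrow> bool" where
  "separating G \<C> W Z \<longleftrightarrow> Z \<subseteq> edges G \<and>
     (\<forall>Q. Q \<subseteq> W \<and> conn (edges G - Z) Q \<longrightarrow> (\<exists>C\<in>\<C>. \<not> touching (edges G) C Q))"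

lemma touching_mono: "touching E X Y \<Longrightarrow> Y \<subseteq> Y' \<Longrightarrow> touching E X Y'"
  unfolding touching_def by blast

lemma touching_Un: "touching E X (Y \<union> Z) \<longleftrightarrow> touching E X Y \<or> touching E X Z"
  unfolding touching_def by blast

text \<open>
  As \<open>W\<close> is connected, \<open>Z\<close> contains an edge between \<open>K\<close> and \<open>L\<close>. If \<open>L\<close> did not touch \<open>C\<close>, then neither
  would \<open>K \<union> L\<close>, and all edges between \<open>K\<close> and \<open>L\<close> could be removed from \<open>Z\<close>: a set \<open>Q\<close> that is
  connected afterwards either lies in \<open>K \<union> L\<close>, which no other edge outside \<open>Z\<close> leaves within \<open>W\<close>,
  or is disjoint from it and was connected before.
\<close>

lemma minimal_separating_component_touches:
  assumes G: "simple_graph G" and W: "conn (edges G) W"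
    and Z: "separating G \<C> W Z" and min: "\<And>Z'. separating G \<C> W Z' \<Longrightarrow> card Z \<le> card Z'"
    and K: "K \<in> components (edges G - Z) W" and C: "C \<in> \<C>" "\<not> touching (edges G) C K"
    and L: "L \<in> components (edges G) (W - K)"
  shows "touching (edges G) C L"
proof (rule ccontr)
  assume nt: "\<not> touching (edges G) C L"
  let ?E = "edges G"
  have finE: "finite ?E" using G by (rule simple_graph_finite_edges)
  have KW: "K \<subseteq> W" and K0: "K \<noteq> {}" using componentsD[OF K] conn_nonempty by blast+
  have LW: "L \<subseteq> W - K" and L0: "L \<noteq> {}" using componentsD[OF L] conn_nonempty by blast+
  have "\<not> W \<subseteq> L" using KW K0 LW by blast
  obtain l where l: "l \<in> L" using L0 by blast
  then have "\<exists>x y. x \<in> L \<and> y \<in> W \<and> {x, y} \<in> ?E \<and> y \<notin> L"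
    using conn_subset_closed[OF W, of l L] \<open>\<not> W \<subseteq> L\<close> LW by blast
  then obtain x y where xy: "x \<in> L" "y \<in> W" "{x, y} \<in> ?E" "y \<notin> L" by blast
  then have "y \<in> K" using components_edge_closed[OF L] by blast
  have "{y, x} \<in> ?E" using xy(3) by (simp add: insert_commute)
  then have "{y, x} \<in> Z"
    using components_edge_closed[OF K \<open>y \<in> K\<close>, of x] xy(1) LW by blast
  define Z' where "Z' = Z - edges_between ?E K L"
  have "{y, x} \<in> edges_between ?E K L"
    using \<open>y \<in> K\<close> xy(1) \<open>{y, x} \<in> ?E\<close> by (auto simp: edges_between_def)
  then have "Z' \<subset> Z" using \<open>{y, x} \<in> Z\<close> by (auto simp: Z'_def)
  moreover have "finite Z" using Z finE finite_subset by (auto simp: separating_def)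
  ultimately have "card Z' < card Z" by (rule psubset_card_mono[rotated])
  moreover have "separating G \<C> W Z'"
    unfolding separating_def
  proof (intro conjI allI impI)
    show "Z' \<subseteq> ?E" using Z by (auto simp: separating_def Z'_def)
    fix Q assume "Q \<subseteq> W \<and> conn (?E - Z') Q"
    then have Q: "Q \<subseteq> W" "conn (?E - Z') Q" by blast+
    show "\<exists>C\<in>\<C>. \<not> touching ?E C Q"
    proof (cases "Q \<inter> (K \<union> L) = {}")
      case True
      have "conn (?E - Z) Q"
      proof (rule conn_transfer[OF Q(2)])
        fix u v assume "u \<in> Q" "v \<in> Q" "{u, v} \<in> ?E - Z'"
        then show "{u, v} \<in> ?E - Z" using True by (auto simp: Z'_def edges_between_def)
      qed
      then show ?thesis using Z Q(1) by (auto simp: separating_def)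
    next
      case False
      then obtain q where q: "q \<in> Q" "q \<in> K \<union> L" by blast
      have "Q \<subseteq> K \<union> L"
      proof (rule conn_subset_closed[OF Q(2) q])
        fix u v assume uv: "u \<in> K \<union> L" "u \<in> Q" "v \<in> Q" "{u, v} \<in> ?E - Z'"
        have v: "v \<in> W" using uv(3) Q(1) by blast
        show "v \<in> K \<union> L"
        proof (cases "u \<in> K")
          case True
          show ?thesis
          proof (cases "{u, v} \<in> Z")
            case True
            then have "{u, v} \<inter> L \<noteq> {}" using uv(4) by (auto simp: Z'_def edges_between_def)
            then show ?thesis using \<open>u \<in> K\<close> LW by blast
          next
            case False
            then show ?thesis using components_edge_closed[OF K True v] uv(4) by blast
          qed
        next
          case False
          then have "u \<in> L" using uv(1) by blast
          then show ?thesis using components_edge_closed[OF L, of u v] v uv(4) by blast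
        qed
      qed
      then have "\<not> touching ?E C Q" using C(2) nt touching_mono touching_Un by metis
      then show ?thesis using C(1) by blast
    qed
  qed
  ultimately show False using min by fastforce
qed

text \<open>
  The bag consists of the boundary of \<open>W\<close> and those edges of a smallest separating set \<open>Z\<close> that join
  different components. For a component \<open>K\<close> that does not touch \<open>C\<close>, the rest of \<open>W\<close> is
  absorbed into \<open>C\<close>, so the number of surrounding sets does not grow.
\<close>

lemma extendable_by_cut:
  assumes G: "simple_graph G" "\<not> is_minor (complete_graph t) G"
    and reg: "clique_region G k \<C> W"
    and ex: "separating G \<C> W Z0" "card Z0 \<le> k"
    and IH: "\<And>\<C>' W'. W' \<subset> W \<Longrightarrow> clique_region G k \<C>' W' \<Longrightarrow> extendable (edges G) N W'"
    and N: "N = (t - 1) * k"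
  shows "extendable (edges G) N W"
proof -
  let ?E = "edges G"
  obtain Z where Z: "separating G \<C> W Z" and min: "\<And>Z'. separating G \<C> W Z' \<Longrightarrow> card Z \<le> card Z'"
    using ex_has_least_nat[of "separating G \<C> W" Z0 card] ex(1) by blast
  have Zk: "card Z \<le> k" using min[OF ex(1)] ex(2) by simp
  have ZE: "Z \<subseteq> ?E" using Z by (simp add: separating_def)
  define \<W> where "\<W> = components (?E - Z) W"
  define R where "R = boundary ?E W \<union> (\<Union>K\<in>\<W>. boundary ?E K)"
  have finE: "finite ?E" using G(1) by (rule simple_graph_finite_edges)
  note W = clique_regionD(1,2)[OF reg] and fin = clique_regionD(3)[OF reg]
    and C = clique_regionD(4)[OF reg] and pair = clique_regionD(5)[OF reg] and bd = clique_regionD(6)[OF reg]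
  have finW: "finite W" using W(1) G(1) finite_subset by (auto simp: simple_graph_def)
  have sub: "K \<subseteq> W" if "K \<in> \<W>" for K using that componentsD unfolding \<W>_def by blast
  have in_Z: "{a, b} \<in> Z" if "K \<in> \<W>" "a \<in> K" "b \<in> W" "b \<notin> K" "{a, b} \<in> ?E" for K a b
    using components_edge_closed[of K "?E - Z" W a b] that unfolding \<W>_def by blast
  have disj: "K \<inter> L = {}" if "K \<in> \<W>" "L \<in> \<W>" "K \<noteq> L" for K L
    using that components_disjoint unfolding \<W>_def by blast
  have bdK: "boundary ?E K \<subseteq> boundary ?E W \<union> Z" if K: "K \<in> \<W>" for K
  proof
    fix e assume e: "e \<in> boundary ?E K"
    then have eE: "e \<in> ?E" by (simp add: boundary_def)
    obtain a b where ab: "e = {a, b}" "a \<in> K" "b \<notin> K"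
      by (rule boundaryE[OF G(1) e])
    show "e \<in> boundary ?E W \<union> Z"
    proof (cases "b \<in> W")
      case True
      then show ?thesis using in_Z[OF K ab(2) True ab(3)] ab(1) eE by blast
    next
      case False
      then show ?thesis using ab eE sub[OF K] by (auto simp: boundary_def)
    qed
  qed
  have R1: "boundary ?E W \<subseteq> R" by (simp add: R_def)
  have R2: "R \<subseteq> edges_meeting ?E W"
    using sub by (fastforce simp: R_def boundary_def edges_meeting_def)
  have "R \<subseteq> boundary ?E W \<union> Z" using bdK by (auto simp: R_def)
  then have R3: "finite R" "card R \<le> N"
    using clique_region_bag_card[OF reg G _ ZE Zk] N by blast+
  have finWW: "finite \<W>" by (rule finite_subset[of _ "Pow W"]) (use sub finW in auto)
  have ext: "extendable ?E N K" if K: "K \<in> \<W>" for K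
  proof -
    have connK: "conn (?E - Z) K" using K componentsD(2) unfolding \<W>_def by blast
    obtain C where C0: "C \<in> \<C>" "\<not> touching ?E C K"
      using Z connK sub[OF K] unfolding separating_def by blast
    define D where "D = C \<union> (W - K)"
    \<comment> \<open>This is where the minimality of \<open>Z\<close> is used; it makes \<open>D\<close> connected.\<close>
    have touch: "touching ?E C L" if "L \<in> components ?E (W - K)" for L
      using minimal_separating_component_touches[OF G(1) W(2) Z min _ C0 that] K
      unfolding \<W>_def by blast
    have connD: "conn ?E D"
      using conn_Un_family[of ?E C "components ?E (W - K)"] C[OF C0(1)] touch
      by (simp add: D_def Union_components componentsD(2))
    have KW: "K \<subset> W" using sub[OF K] C[OF C0(1)] C0(2) by blast
    have DK: "D \<inter> K = {}" using C[OF C0(1)] sub[OF K] unfolding D_def by blast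
    have DZ: "edges_between ?E D K \<subseteq> Z"
    proof
      fix e assume e: "e \<in> edges_between ?E D K"
      then have eE: "e \<in> ?E" by (simp add: edges_between_def)
      obtain a b where ab: "e = {a, b}" "a \<in> K" "b \<notin> K"
        by (rule edge_endsE[OF G(1) eE, of K]) (use e DK in \<open>auto simp: edges_between_def\<close>)
      have "b \<in> D" using e ab DK unfolding edges_between_def by blast
      moreover have "{b, a} \<in> ?E" using eE ab(1) by (simp add: insert_commute)
      then have "b \<notin> C" using C0(2) ab(2) unfolding touching_def by blast
      ultimately have "b \<in> W" unfolding D_def by blast
      then show "e \<in> Z" using in_Z[OF K ab(2) _ ab(3)] eE ab(1) by blast
    qed
    have "clique_region G k {X \<in> insert D (\<C> - {C}). touching ?E X K} K"
    proof (rule clique_region_restrict[OF G(1)])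
      show "K \<subseteq> verts G" using sub[OF K] W(1) by blast
      show "conn ?E K" by (rule conn_transfer[OF connK]) blast
      show "finite (insert D (\<C> - {C}))" using fin by simp
    next
      fix X assume X: "X \<in> insert D (\<C> - {C})"
      show "X \<subseteq> verts G \<and> conn ?E X \<and> X \<inter> K = {} \<and> card (edges_between ?E X K) \<le> k"
      proof (cases "X = D")
        case True
        have "card (edges_between ?E D K) \<le> card Z"
          using DZ ZE finE finite_subset by (intro card_mono) auto
        moreover have "D \<subseteq> verts G" using C[OF C0(1)] W(1) unfolding D_def by blast
        ultimately show ?thesis using True connD DK Zk by simp
      next
        case False
        then have XC: "X \<in> \<C>" using X by blast
        have "edges_between ?E X K \<subseteq> edges_between ?E X W"
          using sub[OF K] by (auto simp: edges_between_def)
        then have "card (edges_between ?E X K) \<le> card (edges_between ?E X W)"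
          using finE by (intro card_mono) (auto simp: edges_between_def)
        moreover have "X \<inter> K = {}" using C[OF XC] sub[OF K] by blast
        ultimately show ?thesis using C[OF XC] by simp
      qed
    next
      have with_D: "X \<inter> D = {} \<and> touching ?E X D" if "X \<in> \<C> - {C}" for X
      proof -
        have "X \<in> \<C>" "X \<noteq> C" using that by blast+
        then have "X \<inter> C = {}" "touching ?E X C" "X \<inter> W = {}"
          using pair[of X C] C[of X] C0(1) by blast+
        then show ?thesis using touching_mono[of ?E X C D] unfolding D_def by blast
      qed
      fix X Y assume XY: "X \<in> insert D (\<C> - {C})" "Y \<in> insert D (\<C> - {C})" "X \<noteq> Y"
      show "X \<inter> Y = {} \<and> touching ?E X Y"
      proof (cases "X = D \<or> Y = D")
        case True
        then obtain V where V: "V \<in> \<C> - {C}" "X = D \<and> Y = V \<or> X = V \<and> Y = D" using XY by blast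
        then show ?thesis using with_D[OF V(1)] touching_sym[of ?E V D] by blast
      qed (use XY pair in blast)
    next
      show "boundary ?E K \<subseteq> (\<Union>X\<in>insert D (\<C> - {C}). edges_between ?E X K)"
      proof
        fix e assume e: "e \<in> boundary ?E K"
        then have eE: "e \<in> ?E" by (simp add: boundary_def)
        obtain a b where ab: "e = {a, b}" "a \<in> K" "b \<notin> K"
          by (rule boundaryE[OF G(1) e])
        have "\<exists>X\<in>insert D (\<C> - {C}). b \<in> X"
        proof (cases "b \<in> W")
          case True
          then show ?thesis using ab(3) by (auto simp: D_def)
        next
          case False
          then have "e \<in> boundary ?E W" using ab eE sub[OF K] by (auto simp: boundary_def)
          then obtain X where X: "X \<in> \<C>" "e \<inter> X \<noteq> {}" using bd unfolding edges_between_def by blast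
          have "a \<notin> X" using C[OF X(1)] ab(2) sub[OF K] by blast
          then have "b \<in> X" using X(2) ab(1) by blast
          then show ?thesis using X(1) by (cases "X = C") (auto simp: D_def)
        qed
        then show "e \<in> (\<Union>X\<in>insert D (\<C> - {C}). edges_between ?E X K)"
          using eE ab by (auto simp: edges_between_def)
      qed
    qed
    then show ?thesis by (rule IH[OF KW])
  qed
  have bd_disj: "R \<inter> edges_meeting ?E K \<subseteq> boundary ?E K" if K: "K \<in> \<W>" for K
  proof
    fix e assume e: "e \<in> R \<inter> edges_meeting ?E K"
    then have "e \<in> ?E" "e \<inter> K \<noteq> {}" by (auto simp: edges_meeting_def)
    moreover have "\<not> e \<subseteq> K"
    proof
      assume eK: "e \<subseteq> K"
      then have "e \<notin> boundary ?E W" using sub[OF K] by (auto simp: boundary_def)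
      then obtain L where L: "L \<in> \<W>" "e \<in> boundary ?E L" using e by (auto simp: R_def)
      then have "K \<noteq> L" "e \<inter> L \<noteq> {}" using eK by (auto simp: boundary_def)
      then show False using disj[OF K L(1)] eK by blast
    qed
    ultimately show "e \<in> boundary ?E K" by (simp add: boundary_def)
  qed
  have "\<Union>\<W> = W" unfolding \<W>_def by (rule Union_components)
  then show ?thesis
    by (intro extendable_split[OF R1 R2 R3 finWW sub ext disj _ bd_disj])
      (auto simp: R_def)
qed

text \<open>
  By induction on the size of the region. If no small connector exists, then there is a separating
  set of at most \<open>(card \<C> - 1) * m / r \<le> (t - 3) * m / r \<le> k\<close> edges, where \<open>m\<close> is the number of edges.
\<close>

lemma clique_region_extendable:
  assumes G: "simple_graph G" "\<not> is_minor (complete_graph t) G"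
    and deg: "\<And>v. v \<in> verts G \<Longrightarrow> card (edges_meeting (edges G) {v}) \<le> \<Delta>"
    and r: "1 \<le> r" "r * \<Delta> \<le> k" "\<And>z. r * z \<le> (t - 3) * card (edges G) \<Longrightarrow> z \<le> k"
    and reg: "clique_region G k \<C> W"
  shows "extendable (edges G) ((t - 1) * k) W"
  using reg
proof (induction "card W" arbitrary: W \<C> rule: less_induct)
  case less
  let ?E = "edges G"
  note W = clique_regionD(1,2)[OF less.prems] and fin = clique_regionD(3)[OF less.prems]
  have finE: "finite ?E" using G(1) by (rule simple_graph_finite_edges)
  have finW: "finite W" using W(1) G(1) finite_subset by (auto simp: simple_graph_def)
  have IH: "extendable ?E ((t - 1) * k) W'" if "W' \<subset> W" "clique_region G k \<C>' W'" for \<C>' W'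
    using less.hyps[OF _ that(2)] psubset_card_mono[OF finW that(1)] by blast
  have few: "card (edges_meeting ?E T) \<le> k" if T: "T \<subseteq> W" "card T \<le> r" for T
  proof -
    have "card (edges_meeting ?E T) \<le> (\<Sum>v\<in>T. card (edges_meeting ?E {v}))"
      unfolding edges_meeting_Union[of ?E T] using finite_subset[OF T(1) finW] by (rule card_UN_le)
    also have "\<dots> \<le> (\<Sum>v\<in>T. \<Delta>)" by (rule sum_mono) (use T(1) W(1) deg in blast)
    also have "\<dots> \<le> r * \<Delta>" using T(2) by simp
    finally show ?thesis using r(2) by simp
  qed
  show ?case
  proof (cases "\<exists>T. T \<subseteq> W \<and> conn ?E T \<and> card T \<le> r \<and> (\<forall>C\<in>\<C>. touching ?E C T)")
    case True
    then obtain T where T: "T \<subseteq> W" "conn ?E T" "card T \<le> r" "\<forall>C\<in>\<C>. touching ?E C T" by blast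
    show ?thesis
      by (rule extendable_by_connector[OF G less.prems T(1,2) few[OF T(1,3)] _ IH refl])
        (use T(4) in blast)
  next
    case False
    \<comment> \<open>A single vertex is a connector when there is nothing to connect.\<close>
    have "\<C> \<noteq> {}"
    proof
      assume "\<C> = {}"
      obtain w where "w \<in> W" using conn_nonempty[OF W(2)] by blast
      then have "{w} \<subseteq> W" "card {w} \<le> r" using r(1) by auto
      then show False using False \<open>\<C> = {}\<close> conn_singleton[of ?E w] by blast
    qed
    obtain Cs where Cs: "set Cs = \<C>" "distinct Cs" using finite_distinct_list[OF fin] by blast
    define nbhd where "nbhd C = {w. \<exists>c\<in>C. {c, w} \<in> ?E}" for C
    have nbhd: "Q \<inter> nbhd C = {} \<longleftrightarrow> \<not> touching ?E C Q" for Q C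
      unfolding nbhd_def touching_def by blast
    have len: "length Cs = card \<C>" using Cs distinct_card by fastforce
    have "\<exists>Z. Z \<subseteq> ?E \<and> r * card Z \<le> (length (map nbhd Cs) - 1) * card ?E \<and>
      (\<forall>Q. Q \<subseteq> W \<and> conn (?E - Z) Q \<longrightarrow> (\<exists>A\<in>set (map nbhd Cs). Q \<inter> A = {}))"
    proof (rule small_connector_or_small_cut[OF finE _ r(1)])
      show "map nbhd Cs \<noteq> []" using Cs(1) \<open>\<C> \<noteq> {}\<close> by auto
      fix T assume "T \<subseteq> W" "conn ?E T" "finite T" "card T \<le> r"
      then show "\<exists>A\<in>set (map nbhd Cs). T \<inter> A = {}" using False Cs(1) by (auto simp: nbhd)
    qed
    then obtain Z where Z: "Z \<subseteq> ?E" "r * card Z \<le> (card \<C> - 1) * card ?E"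
      "\<forall>Q. Q \<subseteq> W \<and> conn (?E - Z) Q \<longrightarrow> (\<exists>A\<in>set (map nbhd Cs). Q \<inter> A = {})"
      unfolding length_map len by blast
    have "separating G \<C> W Z" using Z(1,3) Cs(1) by (simp add: separating_def nbhd)
    moreover have "card Z \<le> k"
    proof (rule r(3))
      have "card \<C> - 1 \<le> t - 3" using clique_region_card[OF less.prems G(2)] by simp
      then have "(card \<C> - 1) * card ?E \<le> (t - 3) * card ?E" by (rule mult_le_mono1)
      with Z(2) show "r * card Z \<le> (t - 3) * card ?E" by (rule le_trans)
    qed
    ultimately show ?thesis
      by (rule extendable_by_cut[OF G less.prems _ _ IH refl])
  qed
qed

section \<open>The treewidth of the line graph\<close>

text \<open>
  On the integers, the least element exists only because widths are bounded below; shifting them by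
  one reduces this to the natural numbers.
\<close>

lemma treewidth_le_width:
  fixes T :: "nat ugraph"
  assumes "tree_decomposition G T B"
  shows "treewidth G \<le> width T B"
proof -
  define P where "P w \<longleftrightarrow> (\<exists>(T :: nat ugraph) B. tree_decomposition G T B \<and> width T B = w)" for w
  have lower: "- 1 \<le> w" if w: "P w" for w
  proof -
    obtain T :: "nat ugraph" and B where T: "tree_decomposition G T B" "width T B = w"
      using w unfolding P_def by blast
    have "finite (verts T)" "verts T \<noteq> {}"
      using T(1) by (auto simp: tree_decomposition_def tree_def simple_graph_def connected_graph_def)
    then obtain x where "x \<in> verts T" by blast
    then have "int (card (B x)) - 1 \<le> width T B"
      using \<open>finite (verts T)\<close> unfolding width_def by (intro Max_ge) auto
    then show ?thesis using T(2) by linarith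
  qed
  have P: "P (width T B)" using assms unfolding P_def by blast
  define n where "n = (LEAST n. P (int n - 1))"
  have "P (int (nat (width T B + 1)) - 1)" using P lower[OF P] by simp
  then have Pn: "P (int n - 1)" unfolding n_def by (rule LeastI)
  have least: "int n - 1 \<le> w" if "P w" for w
  proof -
    have "P (int (nat (w + 1)) - 1)" using that lower[OF that] by simp
    then have "n \<le> nat (w + 1)" unfolding n_def by (rule Least_le)
    then show ?thesis using lower[OF that] by linarith
  qed
  have "treewidth G = (LEAST w. P w)" by (simp add: treewidth_def P_def)
  also have "\<dots> = int n - 1" by (rule Least_equality) (use Pn least in auto)
  finally show ?thesis using least[OF P] by simp
qed

lemma boundary_component:
  assumes G: "simple_graph G" and K: "K \<in> components (edges G) (verts G)"
  shows "boundary (edges G) K = {}"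
proof (rule ccontr)
  assume "\<not> ?thesis"
  then obtain e where e: "e \<in> boundary (edges G) K" by blast
  then have eE: "e \<in> edges G" by (simp add: boundary_def)
  obtain a b where ab: "e = {a, b}" "a \<in> K" "b \<notin> K"
    by (rule boundaryE[OF G e])
  have "b \<in> verts G" using G eE ab(1) by (auto simp: simple_graph_def)
  then show False using components_edge_closed[OF K ab(2)] ab eE by blast
qed

text \<open>
  Starting from a single empty bag, all components of the graph are attached. Two adjacent vertices
  of the line graph are edges with a common end, and a common bag for them is one that contains all
  edges at this end.
\<close>

lemma line_graph_treewidth_le:
  assumes G: "simple_graph G" and ext: "\<And>W. W \<in> components (edges G) (verts G) \<Longrightarrow> extendable (edges G) N W"
  shows "treewidth (line_graph G) \<le> int N - 1"
proof -
  let ?E = "edges G" and ?\<W> = "components (edges G) (verts G)"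
  define T0 :: "nat ugraph" where "T0 = Graph {0} {}"
  define B0 :: "nat \<Rightarrow> 'a set set" where "B0 = (\<lambda>_. {})"
  have path0: "is_path T0 u p v \<Longrightarrow> p = [0] \<and> u = 0 \<and> v = 0" for u p v
    by (cases p rule: list.exhaust; cases "tl p") (auto simp: is_path_def T0_def)
  have "is_path T0 0 [0] 0" by (simp add: is_path_def T0_def)
  then have "tree T0"
    using path0 by (auto simp: tree_def simple_graph_def connected_graph_def acyclic_graph_def T0_def)
  then have pd0: "partial_decomposition N T0 B0"
    by (auto simp: partial_decomposition_def B0_def)
  have no_bd: "boundary ?E K = {}" if "K \<in> ?\<W>" for K
    using boundary_component[OF G that] .
  have fin: "finite ?\<W>"
    by (rule finite_subset[of _ "Pow (verts G)"]) (use G in \<open>auto simp: components_def simple_graph_def\<close>)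
  have "\<exists>(T :: nat ugraph) B. partial_decomposition N T B \<and> extends T0 B0 T B \<and>
     covered T B \<subseteq> covered T0 B0 \<union> edges_meeting ?E (\<Union>?\<W>) \<and>
     (\<forall>v\<in>\<Union>?\<W>. \<exists>x\<in>verts T. edges_meeting ?E {v} \<subseteq> B x)"
  proof (rule extend_family[OF fin ext components_disjoint pd0])
    show "0 \<in> verts T0" by (simp add: T0_def)
  qed (auto simp: no_bd covered_def B0_def)
  then obtain T :: "nat ugraph" and B where T: "partial_decomposition N T B"
    "covered T B \<subseteq> covered T0 B0 \<union> edges_meeting ?E (verts G)"
    "\<forall>v\<in>verts G. \<exists>x\<in>verts T. edges_meeting ?E {v} \<subseteq> B x"
    unfolding Union_components by blast
  have star: "\<exists>x\<in>verts T. {e \<in> ?E. v \<in> e} \<subseteq> B x" if "v \<in> verts G" for v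
    using T(3) that by (auto simp: edges_meeting_def)
  have "covered T B \<subseteq> ?E" using T(2) by (auto simp: covered_def B0_def edges_meeting_def)
  moreover have "?E \<subseteq> covered T B"
  proof
    fix e assume e: "e \<in> ?E"
    obtain a b where ab: "e = {a, b}" "a \<in> verts G" using simple_graph_edgeE[OF G e] by metis
    then show "e \<in> covered T B" using star[OF ab(2)] e by (auto simp: covered_def)
  qed
  ultimately have cov: "?E = (\<Union>x\<in>verts T. B x)" unfolding covered_def by blast
  have "\<exists>x\<in>verts T. p \<subseteq> B x" if p: "p \<in> edges (line_graph G)" for p
  proof -
    obtain e f where ef: "p = {e, f}" "e \<in> ?E" "f \<in> ?E" "e \<inter> f \<noteq> {}"
      using p by (auto simp: line_graph_def)
    then obtain v where v: "v \<in> e" "v \<in> f" by blast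
    then have "v \<in> verts G" using G ef(2) by (auto simp: simple_graph_def)
    then show ?thesis using star[of v] ef v by blast
  qed
  then have td: "tree_decomposition (line_graph G) T B"
    using T(1) cov by (simp add: tree_decomposition_def partial_decomposition_def line_graph_def)
  have "finite (verts T)" "verts T \<noteq> {}"
    using td by (auto simp: tree_decomposition_def tree_def simple_graph_def connected_graph_def)
  then have "width T B \<le> int N - 1"
    using T(1) unfolding width_def partial_decomposition_def by (subst Max_le_iff) auto
  then show ?thesis using treewidth_le_width[OF td] by linarith
qed

text \<open>
  With \<open>s = sqrt (q * \<Delta> * m)\<close> and \<open>r\<close> equal to \<open>s / \<Delta>\<close> rounded up, \<open>r * \<Delta> \<le> s + \<Delta>\<close> and
  \<open>q * m / r \<le> s\<close>. If \<open>q * m = 0\<close>, then \<open>r = 1\<close> does; if \<open>\<Delta> = 0\<close>,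
  any \<open>r > q * m\<close> does.
\<close>

lemma balanced_connector_size:
  fixes q \<Delta> m :: nat
  assumes k: "k = nat \<lfloor>sqrt (real q * real \<Delta> * real m) + real \<Delta>\<rfloor>"
  shows "\<exists>r\<ge>1. r * \<Delta> \<le> k \<and> (\<forall>z. r * z \<le> q * m \<longrightarrow> z \<le> k)"
proof -
  define s where "s = sqrt (real q * real \<Delta> * real m)"
  have s0: "0 \<le> s" by (simp add: s_def)
  have le_k: "x \<le> k" if "real x \<le> s + real \<Delta>" for x
    unfolding k s_def[symmetric] using that by (rule le_nat_floor)
  show ?thesis
  proof (cases "q * m = 0 \<or> \<Delta> = 0")
    case True
    then show ?thesis
    proof
      assume "q * m = 0"
      then show ?thesis using le_k[of \<Delta>] s0 by (intro exI[of _ 1]) auto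
    next
      assume D: "\<Delta> = 0"
      have "z = 0" if "Suc (q * m) * z \<le> q * m" for z
        using that by (cases z) auto
      then show ?thesis using D by (intro exI[of _ "Suc (q * m)"]) auto
    qed
  next
    case False
    then have D: "0 < real \<Delta>" and s: "0 < s" by (simp_all add: s_def)
    have s2: "s * s = real q * real \<Delta> * real m" by (simp add: s_def)
    define r where "r = nat \<lceil>s / real \<Delta>\<rceil>"
    have pos: "0 < s / real \<Delta>" using s D by simp
    have r: "s / real \<Delta> \<le> real r" "real r \<le> s / real \<Delta> + 1"
      using pos unfolding r_def by linarith+
    have "1 \<le> r" using r(1) pos by (cases r) auto
    moreover have "r * \<Delta> \<le> k"
    proof (rule le_k)
      have "real r * real \<Delta> \<le> (s / real \<Delta> + 1) * real \<Delta>" using r(2) by (intro mult_right_mono) auto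
      also have "\<dots> = s + real \<Delta>" using D by (simp add: field_simps)
      finally show "real (r * \<Delta>) \<le> s + real \<Delta>" by simp
    qed
    moreover have "z \<le> k" if z: "r * z \<le> q * m" for z
    proof (rule le_k)
      have "(s / real \<Delta>) * real z \<le> real r * real z" using r(1) by (intro mult_right_mono) auto
      also have "\<dots> \<le> real q * real m" using z by (metis of_nat_le_iff of_nat_mult)
      finally have "s * real z \<le> s * s" using D unfolding s2 by (simp add: field_simps)
      then have "real z \<le> s" using s by simp
      then show "real z \<le> s + real \<Delta>" using D by simp
    qed
    ultimately show ?thesis by blast
  qed
qed

theorem theorem3:
  fixes G :: "'a ugraph" and t \<Delta> m :: nat
  assumes "t \<ge> 3"
    and "simple_graph G"
    and "\<not> is_minor (complete_graph t) G"
    and "max_degree G = \<Delta>"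
    and "card (edges G) = m"
  shows "treewidth (line_graph G)
    \<le> (int t - 1) * \<lfloor>sqrt ((real t - 3) * real \<Delta> * real m) + real \<Delta>\<rfloor> - 1"
proof -
  have finV: "finite (verts G)" using assms(2) by (simp add: simple_graph_def)
  have deg: "card (edges_meeting (edges G) {v}) \<le> \<Delta>" if "v \<in> verts G" for v
  proof -
    have "card (edges_meeting (edges G) {v}) = degree G v"
      by (simp add: edges_meeting_def degree_def)
    also have "\<dots> \<le> max_degree G" using that finV unfolding max_degree_def by (intro Max_ge) auto
    finally show ?thesis using assms(4) by simp
  qed
  define k where "k = nat \<lfloor>sqrt (real (t - 3) * real \<Delta> * real m) + real \<Delta>\<rfloor>"
  obtain r where r: "1 \<le> r" "r * \<Delta> \<le> k" "\<And>z. r * z \<le> (t - 3) * m \<Longrightarrow> z \<le> k"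
    using balanced_connector_size[OF k_def] by blast
  have "extendable (edges G) ((t - 1) * k) W" if W: "W \<in> components (edges G) (verts G)" for W
  proof (rule clique_region_extendable[OF assms(2,3) deg r(1,2)])
    have "boundary (edges G) W = {}" by (rule boundary_component[OF assms(2) W])
    then show "clique_region G k {} W" using componentsD[OF W] by (simp add: clique_region_def)
  qed (use r(3) assms(5) in simp_all)
  then have "treewidth (line_graph G) \<le> int ((t - 1) * k) - 1"
    by (rule line_graph_treewidth_le[OF assms(2)])
  moreover have "int k = \<lfloor>sqrt ((real t - 3) * real \<Delta> * real m) + real \<Delta>\<rfloor>"
    using assms(1) by (simp add: k_def of_nat_diff)
  moreover have "int (t - 1) = int t - 1" using assms(1) by simp
  ultimately show ?thesis by (metis of_nat_mult)
qed

end
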